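(* For every integer $d$ and every $\varepsilon > 0$, there exists $K_1 = K_1(\varepsilon, d)$ such that the following holds. For all integers $n, k, t$ such that $K_1 \le k \le n^t$ and $1 \le t \le d-1$ (with $n$ positive), there exists a subset $S \subseteq [n]^d$ that contains at most $k$ points in each $t$-dimensional affine subspace of $\mathbb{R}^d$, and contains at least $(1-\varepsilon)k$ points in each axis-aligned $t$-dimensional affine subspace of $\mathbb{R}^d$ that intersects $[n]^d$. As a consequence, \[ f_{k, d, t}(n) \ge (1-\varepsilon) k n^{d-t}. \]
   Context: $[n] = \{1, \ldots, n\}$. $f_{k,d,t}(n)$ denotes the maximum size of a subset of the $d$-dimensional grid $[n]^d$ that contains at most $k$ points in each $t$-dimensional affine subspace of $\mathbb{R}^d$. A $t$-dimensional affine subspace is axis-aligned if it is a translate of the linear span of $t$ of the standard basis vectors of $\mathbb{R}^d$. *)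

theory Defs
  imports "HOL-Analysis.Analysis"
begin

text \<open>The ambient dimension \<open>d\<close> is \<open>CARD('d)\<close>, where \<open>'d\<close> indexes the coordinates.\<close>

definition grid :: "nat \<Rightarrow> (real ^ 'd) set" where
  "grid n = {x. \<forall>i. \<exists>m\<in>{1..n}. x $ i = real m}"

definition affine_subspace :: "nat \<Rightarrow> (real ^ 'd) set \<Rightarrow> bool" where
  "affine_subspace t A \<longleftrightarrow> affine A \<and> aff_dim A = int t"

definition axis_aligned_subspace :: "nat \<Rightarrow> (real ^ 'd) set \<Rightarrow> bool" where
  "axis_aligned_subspace t A \<longleftrightarrow>
    (\<exists>a I. card I = t \<and> A = (\<lambda>x. a + x) ` span ((\<lambda>i. axis i 1) ` I))"

definition at_most_per_subspace :: "nat \<Rightarrow> nat \<Rightarrow> (real ^ 'd) set \<Rightarrow> bool" where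
  "at_most_per_subspace k t S \<longleftrightarrow> (\<forall>A. affine_subspace t A \<longrightarrow> card (S \<inter> A) \<le> k)"

text \<open>The number \<open>f\<^bsub>k,d,t\<^esub>(n)\<close>; the dimension \<open>d\<close> is passed as \<open>TYPE('d)\<close>. The two lemmas
  below show that the maximum is taken over a finite nonempty set.\<close>

definition max_grid_subset :: "nat \<Rightarrow> 'd::finite itself \<Rightarrow> nat \<Rightarrow> nat \<Rightarrow> nat" where
  "max_grid_subset k _ t n =
    Max {card S |S. S \<subseteq> (grid n :: (real ^ 'd) set) \<and> at_most_per_subspace k t S}"

lemma finite_grid: "finite (grid n :: (real ^ 'd::finite) set)"
proof -
  have "grid n \<subseteq> vec_lambda ` (UNIV \<rightarrow>\<^sub>E real ` {1..n} :: ('d \<Rightarrow> real) set)"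
  proof
    fix x :: "real ^ 'd" assume "x \<in> grid n"
    then have "vec_nth x \<in> UNIV \<rightarrow>\<^sub>E real ` {1..n}"
      by (fastforce simp: grid_def)
    then show "x \<in> vec_lambda ` (UNIV \<rightarrow>\<^sub>E real ` {1..n})"
      by (metis image_eqI vec_nth_inverse)
  qed
  then show ?thesis
    by (rule finite_subset) (simp add: finite_PiE)
qed

lemma max_grid_subset_candidates:
  fixes n k t :: nat
  defines "C \<equiv> {card S |S. S \<subseteq> (grid n :: (real ^ 'd::finite) set) \<and> at_most_per_subspace k t S}"
  shows "finite C" and "C \<noteq> {}"
proof -
  have "C \<subseteq> card ` Pow (grid n :: (real ^ 'd) set)"
    by (auto simp: C_def)
  then show "finite C"
    by (rule finite_subset) (simp add: finite_grid)
  have "card ({} :: (real ^ 'd) set) \<in> C"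
    unfolding C_def at_most_per_subspace_def by force
  then show "C \<noteq> {}" by blast
qed

end

theory Submission
  imports Defs "HOL-Real_Asymp.Real_Asymp"
begin

text \<open>
  Start from the whole grid, where \<open>k = n ^ t\<close>, and thin repeatedly: each step keeps every point
  independently with probability \<open>q \<ge> 1/2\<close>, and the local lemma provides an outcome in which
  everything that is monitored stays close to its expectation. Two kinds of quantities are monitored.
  For the boundedly many directions of flats that are rich in grid points, the number of selected
  points. For all other flats, only the local density of tuples of \<open>M\<close> points in general position
  on a poor flat, where \<open>M\<close> is a constant; these tuples form a hypergraph all of whose codegrees
  have the order of the right power of \<open>k\<close>, with a tiny constant in front of the vertex degrees.
  Under these bounds a point interacts with polynomially many (in \<open>k\<close>) others, while the failure
  probabilities are \<open>exp (- c * sqrt k)\<close>, so \<open>n\<close> never enters. The relative errors \<open>k powr (-1/4)\<close>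
  form a geometric series, and one can descend to any large constant \<open>k\<close>. In the end,
  a poor flat with many selected points would contain too many of the forbidden tuples.

  The bounds in the grid rest on the fact that a flat with at least \<open>n ^ s / L\<close> grid points
  has a direction spanned by lattice vectors of length \<open>O(L)\<close>, so only polynomially many
  (in \<open>L\<close>) such flats pass through a given point.
\<close>

subsection \<open>Bounded differences for Bernoulli subsets\<close>

text \<open>Sampling at the final density in a single step fails: a flat carries up to
  \<open>n ^ t\<close> grid points, so dependencies grow with \<open>n\<close>, while the failure
  bound for a count of expected size \<open>k\<close> involves \<open>k\<close> alone. Each thinning
  step works at its own density \<open>K\<close>, and there both the failure probability and the
  dependence are controlled by \<open>K\<close>. Poor flats cannot be monitored one by one, since
  their number through a point grows with \<open>n\<close>. Hence the hypergraph: codegrees are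
  indexed by small vertex sets, and all of them are carried along, not only vertex degrees, because
  the effect of one point on the codegree of \<open>U\<close> is the codegree of a larger set. The
  final contradiction compares two multiples of \<open>k ^ (M - 1)\<close>: an overfull poor flat
  forces at least \<eta> times this many tuples through one of its points, while the degrees are
  only about \<open>b / L\<close> times it. Since \<open>M\<close>, \<open>b\<close> and \<eta> do
  not involve \<open>L\<close>, the latter can be chosen large afterwards; it then fixes the number
  \<open>D\<close> of rich flats through a point, and only then the threshold for \<open>k\<close>
  is chosen.\<close>

definition bernoulli_weight :: "real \<Rightarrow> 'a set \<Rightarrow> 'a set \<Rightarrow> real" where
  "bernoulli_weight q X S = q ^ card S * (1 - q) ^ card (X - S)"

definition bexp :: "real \<Rightarrow> 'a set \<Rightarrow> ('a set \<Rightarrow> real) \<Rightarrow> real" where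
  "bexp q X f = (\<Sum>S\<in>Pow X. bernoulli_weight q X S * f S)"

lemma bexp_empty [simp]: "bexp q {} f = f {}"
  by (simp add: bexp_def bernoulli_weight_def)

text \<open>Conditioning on whether \<open>x\<close> is kept. This recursion replaces product
  measures: independence, survival probabilities and the exponential moment bound are all inductions
  along it.\<close>

lemma bexp_insert:
  assumes "finite X" "x \<notin> X"
  shows "bexp q (insert x X) f = q * bexp q X (\<lambda>S. f (insert x S)) + (1 - q) * bexp q X f"
proof -
  have fin: "finite S" if "S \<in> Pow X" for S
    using that assms(1) finite_subset by auto
  have inj: "inj_on (insert x) (Pow X)"
    using assms(2) by (auto simp: inj_on_def)
  have "bexp q (insert x X) f = (\<Sum>S\<in>Pow X. bernoulli_weight q (insert x X) S * f S)
      + (\<Sum>S\<in>insert x ` Pow X. bernoulli_weight q (insert x X) S * f S)"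
    unfolding bexp_def Pow_insert using assms by (intro sum.union_disjoint) auto
  also have "(\<Sum>S\<in>insert x ` Pow X. bernoulli_weight q (insert x X) S * f S)
      = (\<Sum>S\<in>Pow X. bernoulli_weight q (insert x X) (insert x S) * f (insert x S))"
    by (simp add: sum.reindex[OF inj])
  also have "\<dots> = q * bexp q X (\<lambda>S. f (insert x S))"
    unfolding bexp_def sum_distrib_left
  proof (rule sum.cong[OF refl])
    fix S assume S: "S \<in> Pow X"
    then have "x \<notin> S" using assms(2) by auto
    moreover have "insert x X - insert x S = X - S" using assms(2) by auto
    ultimately show "bernoulli_weight q (insert x X) (insert x S) * f (insert x S)
        = q * (bernoulli_weight q X S * f (insert x S))"
      using fin[OF S] by (simp add: bernoulli_weight_def)
  qed
  also have "(\<Sum>S\<in>Pow X. bernoulli_weight q (insert x X) S * f S) = (1 - q) * bexp q X f"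
    unfolding bexp_def sum_distrib_left
  proof (rule sum.cong[OF refl])
    fix S assume S: "S \<in> Pow X"
    then have "insert x X - S = insert x (X - S)" using assms(2) by auto
    then show "bernoulli_weight q (insert x X) S * f S = (1 - q) * (bernoulli_weight q X S * f S)"
      using assms by (simp add: bernoulli_weight_def)
  qed
  finally show ?thesis by simp
qed

lemma bexp_add: "bexp q X (\<lambda>S. f S + g S) = bexp q X f + bexp q X g"
  by (simp add: bexp_def algebra_simps sum.distrib)

lemma bexp_cmult: "bexp q X (\<lambda>S. c * f S) = c * bexp q X f"
  by (simp add: bexp_def sum_distrib_left algebra_simps)

lemma bexp_sum: "bexp q X (\<lambda>S. \<Sum>i\<in>I. f i S) = (\<Sum>i\<in>I. bexp q X (f i))"
  unfolding bexp_def sum_distrib_left by (rule sum.swap)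

lemma bexp_const: "finite X \<Longrightarrow> bexp q X (\<lambda>_. c) = c"
  by (induction X rule: finite_induct) (simp_all add: bexp_insert algebra_simps)

lemma bexp_mono:
  assumes "0 \<le> q" "q \<le> 1" "\<And>S. S \<subseteq> X \<Longrightarrow> f S \<le> g S"
  shows "bexp q X f \<le> bexp q X g"
  unfolding bexp_def bernoulli_weight_def using assms
  by (intro sum_mono mult_left_mono) auto

text \<open>Independence of the selection inside \<open>Y\<close> from the selection outside it;
  this is what the local lemma needs.\<close>

lemma bexp_factor:
  assumes "finite X"
  shows "bexp q X (\<lambda>S. f (S \<inter> Y) * g (S - Y)) = bexp q X (\<lambda>S. f (S \<inter> Y)) * bexp q X (\<lambda>S. g (S - Y))"
  using assms
proof (induction X arbitrary: f g rule: finite_induct)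
  case (insert x X)
  show ?case
  proof (cases "x \<in> Y")
    case True
    then show ?thesis
      using insert.IH[of "\<lambda>S. f (insert x S)" g] insert.IH[of f g] insert.hyps
      by (simp add: bexp_insert Int_insert_left insert_Diff_if algebra_simps)
  next
    case False
    then show ?thesis
      using insert.IH[of f "\<lambda>S. g (insert x S)"] insert.IH[of f g] insert.hyps
      by (simp add: bexp_insert Int_insert_left insert_Diff_if algebra_simps)
  qed
qed simp

lemma bexp_superset:
  assumes "finite X" "Q \<subseteq> X"
  shows "bexp q X (\<lambda>S. of_bool (Q \<subseteq> S)) = q ^ card Q"
  using assms
proof (induction X arbitrary: Q rule: finite_induct)
  case (insert x X)
  show ?case
  proof (cases "x \<in> Q")
    case True
    have finQ: "finite Q" using insert by (meson finite.insertI finite_subset)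
    have "bexp q X (\<lambda>S. of_bool (Q \<subseteq> S)) = bexp q X (\<lambda>S. 0)"
      unfolding bexp_def using True insert.hyps by (intro sum.cong) auto
    moreover have sub: "(Q \<subseteq> insert x S) = (Q - {x} \<subseteq> S)" for S by auto
    have "bexp q X (\<lambda>S. of_bool (Q \<subseteq> insert x S)) = q ^ card (Q - {x})"
      unfolding sub by (rule insert.IH) (use insert.prems in blast)
    moreover have "card Q = Suc (card (Q - {x}))"
      using True finQ by (metis card.remove)
    ultimately show ?thesis
      using insert.hyps by (simp add: bexp_insert bexp_const)
  next
    case False
    then have "Q \<subseteq> X" "\<And>S. (Q \<subseteq> insert x S) = (Q \<subseteq> S)" using insert.prems by auto
    then show ?thesis
      using insert.IH[of Q] insert.hyps by (simp add: bexp_insert algebra_simps)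
  qed
qed simp

section \<open>Exponential moments and concentration\<close>

text \<open>For a centred variable the linear term averages to zero, so this bounds its exponential
  moment by \<open>exp\<close> of a square.\<close>

lemma exp_le_add_exp_square: "exp (x::real) \<le> x + exp (x\<^sup>2)"
proof -
  consider "x \<ge> 1" | "0 \<le> x" "x \<le> 1" | "x < 0" by linarith
  then show ?thesis
  proof cases
    case 1
    then have "x \<le> x\<^sup>2" by (simp add: power2_eq_square)
    then have "exp x \<le> exp (x\<^sup>2)" by simp
    with 1 show ?thesis by linarith
  next
    case 2
    then show ?thesis using exp_bound[of x] exp_ge_add_one_self[of "x\<^sup>2"] by linarith
  next
    case 3
    \<comment> \<open>It suffices that \<open>exp (- y) \<le> 1 - y + y\<^sup>2\<close>, which
      follows by multiplying \<open>1 - y + y\<^sup>2\<close> with the quadratic Taylor bound for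
      \<open>exp y\<close>: the product exceeds 1 by terms that are nonnegative for
      \<open>y > 0\<close>.\<close>
    define y where "y = - x"
    have y: "y > 0" using 3 by (simp add: y_def)
    have sq: "1 - y + y\<^sup>2 = (y - 1/2)\<^sup>2 + 3/4"
      by (simp add: power2_eq_square field_simps)
    have pos: "1 - y + y\<^sup>2 > 0" unfolding sq by (simp add: add_nonneg_pos)
    have 1: "(1 - y + y\<^sup>2) * (2 + 2 * y + y\<^sup>2) = 2 + y\<^sup>2 + y^3 + y^4" by algebra
    have 2: "y\<^sup>2 + y^3 + y^4 \<ge> 0" using y by (intro add_nonneg_nonneg) auto
    have 3: "(1 - y + y\<^sup>2) * (1 + y + y\<^sup>2 / 2) = ((1 - y + y\<^sup>2) * (2 + 2 * y + y\<^sup>2)) / 2"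
      by (simp only: times_divide_eq_right [symmetric]) (simp only: add_divide_distrib, simp)
    have "1 \<le> (1 - y + y\<^sup>2) * (1 + y + y\<^sup>2 / 2)" unfolding 3 1 using 2 by simp
    also have "\<dots> \<le> (1 - y + y\<^sup>2) * exp y"
      using pos exp_lower_Taylor_quadratic[of y] y by (intro mult_left_mono) auto
    finally have "exp (- y) \<le> 1 - y + y\<^sup>2"
      by (simp add: exp_minus inverse_eq_divide pos_divide_le_eq)
    then have "exp x \<le> 1 + x + x\<^sup>2" by (simp add: y_def)
    then show ?thesis using exp_ge_add_one_self[of "x\<^sup>2"] by linarith
  qed
qed

lemma two_point_mgf:
  fixes a b q s c :: real
  assumes "0 \<le> q" "q \<le> 1" "\<bar>a - b\<bar> \<le> c"
  defines "m \<equiv> q * a + (1 - q) * b"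
  shows "q * exp (s * (a - m)) + (1 - q) * exp (s * (b - m)) \<le> exp (s\<^sup>2 * c\<^sup>2)"
proof -
  have am: "a - m = (1 - q) * (a - b)" "b - m = q * (b - a)" by (simp_all add: m_def algebra_simps)
  have bd: "\<bar>a - m\<bar> \<le> \<bar>a - b\<bar>" "\<bar>b - m\<bar> \<le> \<bar>a - b\<bar>"
    unfolding am abs_mult using assms(1,2) mult_left_le_one_le[of "\<bar>a-b\<bar>" "\<bar>1-q\<bar>"]
      mult_left_le_one_le[of "\<bar>b-a\<bar>" "\<bar>q\<bar>"] by auto
  have e: "exp (s * y) \<le> s * y + exp (s\<^sup>2 * c\<^sup>2)" if "\<bar>y\<bar> \<le> \<bar>a - b\<bar>" for y
  proof -
    have "\<bar>y\<bar> \<le> \<bar>c\<bar>" using that assms(3) by linarith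
    then have "(s * y)\<^sup>2 \<le> s\<^sup>2 * c\<^sup>2"
      by (metis abs_le_square_iff mult_left_mono power_mult_distrib zero_le_power2)
    then have "exp ((s * y)\<^sup>2) \<le> exp (s\<^sup>2 * c\<^sup>2)" by simp
    with exp_le_add_exp_square[of "s * y"] show ?thesis by linarith
  qed
  have "q * exp (s * (a - m)) + (1 - q) * exp (s * (b - m))
      \<le> q * (s * (a - m) + exp (s\<^sup>2 * c\<^sup>2)) + (1 - q) * (s * (b - m) + exp (s\<^sup>2 * c\<^sup>2))"
    using e[OF bd(1)] e[OF bd(2)] assms(1,2) by (intro add_mono mult_left_mono) auto
  also have "\<dots> = exp (s\<^sup>2 * c\<^sup>2)" by (simp add: m_def algebra_simps)
  finally show ?thesis .
qed

text \<open>The martingale proof of the bounded differences inequality as an induction. Averaging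
  out \<open>x\<close> turns \<open>f\<close> into \<open>g\<close>, which has the same mean and the
  same difference bounds on the remaining points; given the remaining points, \<open>f - g\<close>
  is a centred two-point variable, which costs the factor
  \<open>exp (s\<^sup>2 * (c x)\<^sup>2)\<close>.\<close>

lemma bounded_differences_mgf:
  fixes f :: "'a set \<Rightarrow> real" and c :: "'a \<Rightarrow> real"
  assumes "finite X" "0 \<le> q" "q \<le> 1"
    and "\<And>x S. x \<in> X \<Longrightarrow> S \<subseteq> X - {x} \<Longrightarrow> \<bar>f (insert x S) - f S\<bar> \<le> c x"
  shows "bexp q X (\<lambda>S. exp (s * (f S - bexp q X f))) \<le> exp (s\<^sup>2 * (\<Sum>x\<in>X. (c x)\<^sup>2))"
  using assms(1,4)
proof (induction X arbitrary: f rule: finite_induct)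
  case (insert x X)
  define g where "g S = q * f (insert x S) + (1 - q) * f S" for S
  have Eg: "bexp q (insert x X) f = bexp q X g"
    unfolding g_def using insert.hyps by (simp add: bexp_insert bexp_add bexp_cmult)
  let ?m = "bexp q X g"
  have IH: "bexp q X (\<lambda>S. exp (s * (g S - ?m))) \<le> exp (s\<^sup>2 * (\<Sum>x\<in>X. (c x)\<^sup>2))"
  proof (rule insert.IH)
    fix y S assume y: "y \<in> X" and S: "S \<subseteq> X - {y}"
    have xy: "x \<noteq> y" using y insert.hyps by auto
    have "\<bar>f (insert y (insert x S)) - f (insert x S)\<bar> \<le> c y"
      using y S xy by (intro insert.prems) auto
    moreover have "\<bar>f (insert y S) - f S\<bar> \<le> c y"
      using y S by (intro insert.prems) (use insert.hyps in auto)
    ultimately have 1: "\<bar>q * (f (insert y (insert x S)) - f (insert x S))\<bar> \<le> q * c y"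
      and 2: "\<bar>(1 - q) * (f (insert y S) - f S)\<bar> \<le> (1 - q) * c y"
      using assms(2,3) by (auto simp: abs_mult intro!: mult_left_mono)
    have "g (insert y S) - g S = q * (f (insert y (insert x S)) - f (insert x S))
        + (1 - q) * (f (insert y S) - f S)"
      by (simp add: g_def insert_commute algebra_simps)
    then have "\<bar>g (insert y S) - g S\<bar> \<le> q * c y + (1 - q) * c y" using 1 2 by linarith
    then show "\<bar>g (insert y S) - g S\<bar> \<le> c y" by (simp add: algebra_simps)
  qed
  have "bexp q (insert x X) (\<lambda>S. exp (s * (f S - ?m)))
      = bexp q X (\<lambda>S. q * exp (s * (f (insert x S) - ?m)) + (1 - q) * exp (s * (f S - ?m)))"
    using insert.hyps by (simp add: bexp_insert bexp_add bexp_cmult)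
  also have "\<dots> \<le> bexp q X (\<lambda>S. exp (s\<^sup>2 * (c x)\<^sup>2) * exp (s * (g S - ?m)))"
  proof (rule bexp_mono[OF assms(2,3)])
    fix S assume "S \<subseteq> X"
    then have d: "\<bar>f (insert x S) - f S\<bar> \<le> c x"
      using insert.hyps by (intro insert.prems) auto
    have sp: "exp (s * (z - ?m)) = exp (s * (z - g S)) * exp (s * (g S - ?m))" for z
      by (simp add: exp_add [symmetric] algebra_simps)
    have "q * exp (s * (f (insert x S) - ?m)) + (1 - q) * exp (s * (f S - ?m))
        = (q * exp (s * (f (insert x S) - g S)) + (1 - q) * exp (s * (f S - g S))) * exp (s * (g S - ?m))"
      unfolding sp[of "f (insert x S)"] sp[of "f S"] by (simp add: algebra_simps)
    also have "\<dots> \<le> exp (s\<^sup>2 * (c x)\<^sup>2) * exp (s * (g S - ?m))"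
      unfolding g_def by (rule mult_right_mono[OF two_point_mgf[OF assms(2,3) d]]) simp
    finally show "q * exp (s * (f (insert x S) - ?m)) + (1 - q) * exp (s * (f S - ?m))
        \<le> exp (s\<^sup>2 * (c x)\<^sup>2) * exp (s * (g S - ?m))" .
  qed
  also have "\<dots> \<le> exp (s\<^sup>2 * (c x)\<^sup>2) * exp (s\<^sup>2 * (\<Sum>x\<in>X. (c x)\<^sup>2))"
    unfolding bexp_cmult using IH by simp
  also have "\<dots> = exp (s\<^sup>2 * (\<Sum>x\<in>insert x X. (c x)\<^sup>2))"
    using insert.hyps by (simp add: exp_add [symmetric] algebra_simps)
  finally show ?case unfolding Eg .
qed simp

lemma bounded_differences_tail:
  fixes f :: "'a set \<Rightarrow> real" and c :: "'a \<Rightarrow> real"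
  assumes "finite X" "0 \<le> q" "q \<le> 1"
    and "\<And>x S. x \<in> X \<Longrightarrow> S \<subseteq> X - {x} \<Longrightarrow> \<bar>f (insert x S) - f S\<bar> \<le> c x"
    and "(\<Sum>x\<in>X. (c x)\<^sup>2) \<le> v" "v > 0" "a \<ge> 0"
  shows "bexp q X (\<lambda>S. of_bool (\<bar>f S - bexp q X f\<bar> > a)) \<le> 2 * exp (- (a\<^sup>2 / (4 * v)))"
proof -
  \<comment> \<open>The minimiser of \<open>- s * a + s\<^sup>2 * v\<close>. Using both
    \<open>s\<close> and \<open>- s\<close> handles the two tails.\<close>
  define s where "s = a / (2 * v)"
  have s: "s \<ge> 0" using assms by (simp add: s_def)
  let ?m = "bexp q X f"
  have mgf: "bexp q X (\<lambda>S. exp (u * (f S - ?m))) \<le> exp (s\<^sup>2 * v)" if "u\<^sup>2 = s\<^sup>2" for u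
  proof -
    have "s\<^sup>2 * (\<Sum>x\<in>X. (c x)\<^sup>2) \<le> s\<^sup>2 * v" using assms(5) by (intro mult_left_mono) auto
    then show ?thesis
      using bounded_differences_mgf[OF assms(1-4), where s=u] that by (simp add: order_trans)
  qed
  have "bexp q X (\<lambda>S. of_bool (\<bar>f S - ?m\<bar> > a))
      \<le> bexp q X (\<lambda>S. exp (- s * a) * exp (s * (f S - ?m)) + exp (- s * a) * exp ((-s) * (f S - ?m)))"
  proof (rule bexp_mono[OF assms(2,3)])
    fix S
    show "of_bool (\<bar>f S - ?m\<bar> > a)
        \<le> exp (- s * a) * exp (s * (f S - ?m)) + exp (- s * a) * exp ((-s) * (f S - ?m))"
    proof (cases "\<bar>f S - ?m\<bar> > a")
      case True
      then consider "f S - ?m > a" | "-(f S - ?m) > a" by linarith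
      then show ?thesis
      proof cases
        case 1
        then have "0 \<le> - s * a + s * (f S - ?m)" using s mult_left_mono[of a "f S - ?m" s] by simp
        then have "1 \<le> exp (- s * a) * exp (s * (f S - ?m))"
          unfolding exp_add [symmetric] one_le_exp_iff .
        moreover have "0 \<le> exp (- s * a) * exp ((-s) * (f S - ?m))" by simp
        ultimately show ?thesis unfolding of_bool_def if_P[OF True] by linarith
      next
        case 2
        then have "0 \<le> - s * a + (-s) * (f S - ?m)" using s mult_left_mono[of a "-(f S - ?m)" s] by (simp add: algebra_simps)
        then have "1 \<le> exp (- s * a) * exp ((-s) * (f S - ?m))"
          unfolding exp_add [symmetric] one_le_exp_iff .
        moreover have "0 \<le> exp (- s * a) * exp (s * (f S - ?m))" by simp
        ultimately show ?thesis unfolding of_bool_def if_P[OF True] by linarith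
      qed
    qed simp
  qed
  also have "\<dots> \<le> exp (- s * a) * exp (s\<^sup>2 * v) + exp (- s * a) * exp (s\<^sup>2 * v)"
    unfolding bexp_add bexp_cmult
    by (intro add_mono mult_left_mono mgf) simp_all
  also have "\<dots> = 2 * exp (- s * a + s\<^sup>2 * v)" by (simp only: exp_add mult_2)
  also have "- s * a + s\<^sup>2 * v = - (a\<^sup>2 / (4 * v))"
  proof -
    have 1: "s * v = a / 2" and 2: "a\<^sup>2 / (4 * v) = s * a / 2"
      using assms(6) by (simp_all add: s_def power2_eq_square)
    have "s\<^sup>2 * v = s * (a / 2)" unfolding 1 [symmetric] by (simp add: power2_eq_square)
    then show ?thesis unfolding 2 by simp
  qed
  finally show ?thesis .
qed

subsection \<open>The local lemma\<close>

lemma sum_UN_le: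
  fixes w :: "'w \<Rightarrow> real"
  assumes "finite J" "\<And>j. j \<in> J \<Longrightarrow> finite (B j)" "\<And>j x. j \<in> J \<Longrightarrow> x \<in> B j \<Longrightarrow> w x \<ge> 0"
  shows "sum w (\<Union>j\<in>J. B j) \<le> (\<Sum>j\<in>J. sum w (B j))"
  using assms
proof (induction J rule: finite_induct)
  case (insert j J)
  have "sum w (B j \<union> (\<Union>j\<in>J. B j)) \<le> sum w (B j) + sum w (\<Union>j\<in>J. B j)"
    using sum_Un[of "B j" "\<Union>j\<in>J. B j" w] sum_nonneg[of "B j \<inter> (\<Union>j\<in>J. B j)" w] insert by force
  with insert show ?case by force
qed simp

text \<open>The symmetric Lovasz local lemma for a finite weighted set. Two claims are proved
  together by induction on \<open>card J\<close>: avoiding the events of \<open>J\<close> has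
  positive weight, and given this, every event has conditional probability at most
  \<open>2 * p\<close>. The second claim is written as a product to avoid division.\<close>

lemma local_lemma:
  fixes w :: "'w \<Rightarrow> real" and E :: "'i \<Rightarrow> 'w set" and G :: "'i \<Rightarrow> 'i set" and D :: real
  assumes fin: "finite \<Omega>" and nonneg: "\<And>x. x \<in> \<Omega> \<Longrightarrow> w x \<ge> 0" and total: "sum w \<Omega> = 1"
    and finI: "finite I" and E: "\<And>i. i \<in> I \<Longrightarrow> E i \<subseteq> \<Omega>"
    and indep: "\<And>i J. i \<in> I \<Longrightarrow> J \<subseteq> I - G i \<Longrightarrow>
      sum w (E i \<inter> (\<Omega> - \<Union>(E ` J))) = sum w (E i) * sum w (\<Omega> - \<Union>(E ` J))"
    and deg: "\<And>i. i \<in> I \<Longrightarrow> real (card (I \<inter> G i)) \<le> D"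
    and p: "\<And>i. i \<in> I \<Longrightarrow> sum w (E i) \<le> p" and "0 \<le> p" and "1 \<le> D" and pD: "4 * p * D \<le> 1"
  shows "sum w (\<Omega> - \<Union>(E ` I)) > 0"
proof -
  define N where "N J = \<Omega> - \<Union>(E ` J)" for J
  have mono: "sum w A \<le> sum w B" if "A \<subseteq> B" "B \<subseteq> \<Omega>" for A B
    using that fin nonneg by (intro sum_mono2) (auto intro: finite_subset)
  have N\<Omega>: "N J \<subseteq> \<Omega>" for J by (auto simp: N_def)
  have p4: "p \<le> 1/4" using pD \<open>0 \<le> p\<close> \<open>1 \<le> D\<close> mult_left_mono[of 1 D "4 * p"] by linarith
  have main: "sum w (N J) > 0 \<and> (\<forall>i\<in>I. sum w (E i \<inter> N J) \<le> 2 * p * sum w (N J))" if "J \<subseteq> I" for J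
    using that
  proof (induction "card J" arbitrary: J rule: less_induct)
    case less
    have finJ: "finite J" using less.prems finI finite_subset by blast
    have pos: "sum w (N J) > 0"
    proof (cases "J = {}")
      case True
      then show ?thesis using total by (simp add: N_def)
    next
      case False
      then obtain j where j: "j \<in> J" by blast
      let ?J = "J - {j}"
      have "card ?J < card J" using j finJ by (meson card_Diff1_less)
      then have IH: "sum w (N ?J) > 0" "sum w (E j \<inter> N ?J) \<le> 2 * p * sum w (N ?J)"
        using less.hyps[of ?J] less.prems j by auto
      have "N ?J = N J \<union> (E j \<inter> N ?J)" "N J \<inter> (E j \<inter> N ?J) = {}"
        using j by (auto simp: N_def)
      then have "sum w (N ?J) = sum w (N J) + sum w (E j \<inter> N ?J)"
        using sum.union_disjoint[of "N J" "E j \<inter> N ?J" w] finite_subset[OF N\<Omega> fin] by auto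
      moreover have "2 * p * sum w (N ?J) \<le> (1/2) * sum w (N ?J)"
        using p4 IH(1) by (intro mult_right_mono) auto
      ultimately show ?thesis using IH by linarith
    qed
    moreover have "sum w (E i \<inter> N J) \<le> 2 * p * sum w (N J)" if i: "i \<in> I" for i
    proof -
      let ?J1 = "J \<inter> G i" and ?J2 = "J - G i"
      have "sum w (E i \<inter> N J) \<le> sum w (E i \<inter> N ?J2)"
        using N\<Omega> by (intro mono) (auto simp: N_def)
      also have "\<dots> = sum w (E i) * sum w (N ?J2)"
        unfolding N_def using i less.prems by (intro indep) auto
      also have "\<dots> \<le> p * sum w (N ?J2)"
        using p[OF i] N\<Omega> nonneg by (intro mult_right_mono sum_nonneg) auto
      finally have 1: "sum w (E i \<inter> N J) \<le> p * sum w (N ?J2)" .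
      \<comment> \<open>Passing from \<open>?J2\<close> to \<open>J\<close> adds only the at most
        \<open>D\<close> neighbouring events, each of conditional probability at most
        \<open>2 * p\<close>; together they remove at most half of the weight, as
        \<open>2 * p * D \<le> 1/2\<close>.\<close>
      have "sum w (N ?J2) \<le> 2 * sum w (N J)"
      proof (cases "?J1 = {}")
        case True
        then have "?J2 = J" by blast
        then show ?thesis using pos by simp
      next
        case False
        then have "card ?J2 < card J" using finJ by (intro psubset_card_mono) auto
        then have IH: "sum w (N ?J2) > 0" "\<And>j. j \<in> I \<Longrightarrow> sum w (E j \<inter> N ?J2) \<le> 2 * p * sum w (N ?J2)"
          using less.hyps[of ?J2] less.prems by auto
        have "N ?J2 = N J \<union> (\<Union>j\<in>?J1. E j \<inter> N ?J2)" "N J \<inter> (\<Union>j\<in>?J1. E j \<inter> N ?J2) = {}"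
          by (auto simp: N_def)
        then have "sum w (N ?J2) = sum w (N J) + sum w (\<Union>j\<in>?J1. E j \<inter> N ?J2)"
          using sum.union_disjoint[of "N J" "\<Union>j\<in>?J1. E j \<inter> N ?J2" w] finJ finite_subset[OF N\<Omega> fin] by auto
        also have "sum w (\<Union>j\<in>?J1. E j \<inter> N ?J2) \<le> (\<Sum>j\<in>?J1. sum w (E j \<inter> N ?J2))"
          using finJ finite_subset[OF N\<Omega> fin] N\<Omega> nonneg by (intro sum_UN_le) auto
        also have "\<dots> \<le> (\<Sum>j\<in>?J1. 2 * p * sum w (N ?J2))"
          using IH(2) less.prems by (intro sum_mono) auto
        also have "\<dots> = real (card ?J1) * (2 * p * sum w (N ?J2))" by simp
        also have "\<dots> \<le> D * (2 * p * sum w (N ?J2))"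
        proof (rule mult_right_mono)
          have "card ?J1 \<le> card (I \<inter> G i)" using finI less.prems by (intro card_mono) auto
          then show "real (card ?J1) \<le> D" using deg[OF i] by linarith
          show "0 \<le> 2 * p * sum w (N ?J2)" using IH(1) \<open>0 \<le> p\<close> by simp
        qed
        also have "\<dots> = (4 * p * D) * (sum w (N ?J2) / 2)" by simp
        also have "\<dots> \<le> 1 * (sum w (N ?J2) / 2)" using pD IH(1) by (intro mult_right_mono) auto
        finally show ?thesis by simp
      qed
      then have "p * sum w (N ?J2) \<le> p * (2 * sum w (N J))" using \<open>0 \<le> p\<close> by (intro mult_left_mono)
      with 1 show ?thesis by simp
    qed
    ultimately show ?case by blast
  qed
  then show ?thesis by (auto simp: N_def)
qed

section \<open>One random thinning step\<close>

lemma sum_card_containing: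
  assumes "finite F" "finite X" "\<And>Q. Q \<in> F \<Longrightarrow> Q \<subseteq> X"
  shows "(\<Sum>x\<in>X. card {Q\<in>F. x \<in> Q}) = (\<Sum>Q\<in>F. card Q)"
proof -
  have "(\<Sum>x\<in>X. card {Q\<in>F. x \<in> Q}) = (\<Sum>x\<in>X. \<Sum>Q\<in>F. of_bool (x \<in> Q))"
    using assms(1) by (simp add: Int_def)
  also have "\<dots> = (\<Sum>Q\<in>F. \<Sum>x\<in>X. of_bool (x \<in> Q))" by (rule sum.swap)
  also have "\<dots> = (\<Sum>Q\<in>F. card Q)"
  proof (rule sum.cong[OF refl])
    fix Q assume "Q \<in> F"
    then have "X \<inter> Q = Q" using assms(3) by blast
    then show "(\<Sum>x\<in>X. of_bool (x \<in> Q)) = card Q" using assms(2) by simp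
  qed
  finally show ?thesis .
qed

text \<open>\<open>V i\<close> is the set of points that decide event \<open>i\<close>. Events whose
  sets avoid \<open>V i\<close> are determined by the selection outside \<open>V i\<close>, so any
  combination of them is independent of event \<open>i\<close>.\<close>

lemma local_lemma_bernoulli:
  fixes V :: "'i \<Rightarrow> 'a set" and B :: "'i \<Rightarrow> 'a set \<Rightarrow> bool"
  assumes fin: "finite X" and q: "0 \<le> q" "q \<le> 1" and finI: "finite I"
    and local: "\<And>i S. i \<in> I \<Longrightarrow> B i (S \<inter> V i) = B i S"
    and p: "\<And>i. i \<in> I \<Longrightarrow> bexp q X (\<lambda>S. of_bool (B i S)) \<le> p"
    and deg: "\<And>i. i \<in> I \<Longrightarrow> real (card {j\<in>I. V i \<inter> V j \<noteq> {}}) \<le> D"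
    and "0 \<le> p" "1 \<le> D" "4 * p * D \<le> 1"
  shows "\<exists>S\<subseteq>X. \<forall>i\<in>I. \<not> B i S"
proof -
  let ?w = "bernoulli_weight q X"
  define E where "E i = {S \<in> Pow X. B i S}" for i
  have w: "sum ?w {S \<in> Pow X. P S} = bexp q X (\<lambda>S. of_bool (P S))" for P
    unfolding bexp_def using fin by (simp add: Int_def)
  have "sum ?w (Pow X - \<Union>(E ` I)) > 0"
  proof (rule local_lemma[where G = "\<lambda>i. {j. V i \<inter> V j \<noteq> {}}" and p = p and D = D])
    show "sum ?w (Pow X) = 1" using w[of "\<lambda>_. True"] bexp_const[OF fin, of q 1] by (simp add: Pow_def)
    show "?w S \<ge> 0" for S using q by (simp add: bernoulli_weight_def)
    show "sum ?w (E i) \<le> p" if "i \<in> I" for i unfolding E_def w using p[OF that] .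
    show "real (card (I \<inter> {j. V i \<inter> V j \<noteq> {}})) \<le> D" if "i \<in> I" for i
      using deg[OF that] by (simp add: Int_def)
    fix i J assume i: "i \<in> I" and J: "J \<subseteq> I - {j. V i \<inter> V j \<noteq> {}}"
    define h where "h S = (\<forall>j\<in>J. \<not> B j S)" for S
    have h: "h (S - V i) = h S" for S
    proof -
      have "B j (S - V i) = B j S" if "j \<in> J" for j
      proof -
        have "(S - V i) \<inter> V j = S \<inter> V j" and "j \<in> I" using J that by auto
        then show ?thesis using local[of j "S - V i"] local[of j S] by simp
      qed
      then show ?thesis by (simp add: h_def)
    qed
    have 1: "Pow X - \<Union>(E ` J) = {S \<in> Pow X. h S}" by (auto simp: E_def h_def)
    have 2: "E i \<inter> {S \<in> Pow X. h S} = {S \<in> Pow X. B i S \<and> h S}" by (auto simp: E_def)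
    show "sum ?w (E i \<inter> (Pow X - \<Union>(E ` J))) = sum ?w (E i) * sum ?w (Pow X - \<Union>(E ` J))"
      unfolding 1 2 unfolding E_def w
      using bexp_factor[OF fin, of q "\<lambda>S. of_bool (B i S)" "V i" "\<lambda>S. of_bool (h S)"]
      by (simp add: local[OF i] h of_bool_conj)
  qed (use assms in \<open>auto simp: E_def\<close>)
  then have "Pow X - \<Union>(E ` I) \<noteq> {}" by (metis less_irrefl sum.empty)
  then show ?thesis by (auto simp: E_def)
qed

text \<open>Toggling a point changes the count by at most its degree, of order
  \<open>K ^ (r - 1)\<close>. The squared degrees sum to at most the maximal degree times the sum of
  degrees, of order \<open>K ^ (r - 1) * K ^ r\<close>. The permitted deviation is
  \<open>K ^ r\<close> divided by the fourth root of \<open>K\<close>; its square exceeds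
  \<open>K ^ (2 * r - 1)\<close> by the factor \<open>sqrt K\<close>, which is what remains in the
  exponent.\<close>

lemma uniform_family_tail:
  fixes K C q :: real and F :: "'a set set"
  assumes fin: "finite X" and q: "0 \<le> q" "q \<le> 1" and F: "F \<subseteq> Pow X"
    and unif: "\<And>Q. Q \<in> F \<Longrightarrow> card Q = r" and r: "1 \<le> r" "r \<le> M"
    and cardF: "real (card F) \<le> C * K ^ r"
    and deg: "\<And>y. y \<in> X \<Longrightarrow> real (card {Q\<in>F. y \<in> Q}) \<le> C * K ^ (r - 1)"
    and "C > 0" "K > 0"
  shows "bexp q X (\<lambda>S. of_bool (\<bar>real (card {Q\<in>F. Q \<subseteq> S}) - q ^ r * real (card F)\<bar> > K ^ r / sqrt (sqrt K)))
    \<le> 2 * exp (- (sqrt K / (4 * real M * C\<^sup>2)))"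
proof -
  define f where "f S = real (card {Q\<in>F. Q \<subseteq> S})" for S
  define c where "c x = real (card {Q\<in>F. x \<in> Q})" for x
  have finF: "finite F" using F fin by (meson finite_Pow_iff finite_subset)
  have M0: "M > 0" using r by simp
  have "f = (\<lambda>S. \<Sum>Q\<in>F. of_bool (Q \<subseteq> S))"
    using finF by (auto simp: f_def Int_def)
  then have "bexp q X f = (\<Sum>Q\<in>F. q ^ card Q)"
    using F by (auto simp: bexp_sum fin bexp_superset intro!: sum.cong)
  also have "\<dots> = q ^ r * real (card F)" using unif by simp
  finally have Ef: "bexp q X f = q ^ r * real (card F)" .
  have diff: "\<bar>f (insert x S) - f S\<bar> \<le> c x" for x S
  proof -
    have "card {Q\<in>F. Q \<subseteq> S} \<le> card {Q\<in>F. Q \<subseteq> insert x S}"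
      using finF by (intro card_mono) auto
    moreover have "card {Q\<in>F. Q \<subseteq> insert x S} \<le> card ({Q\<in>F. Q \<subseteq> S} \<union> {Q\<in>F. x \<in> Q})"
      using finF by (intro card_mono) auto
    moreover have "\<dots> \<le> card {Q\<in>F. Q \<subseteq> S} + card {Q\<in>F. x \<in> Q}" by (rule card_Un_le)
    ultimately show ?thesis unfolding f_def c_def by linarith
  qed
  define v where "v = real M * C\<^sup>2 * K ^ (2 * r - 1)"
  have v0: "v > 0" using assms M0 by (simp add: v_def)
  have "(\<Sum>x\<in>X. (c x)\<^sup>2) \<le> (\<Sum>x\<in>X. C * K ^ (r - 1) * c x)"
    unfolding power2_eq_square c_def using deg by (intro sum_mono mult_right_mono) auto
  also have "\<dots> = C * K ^ (r - 1) * real (\<Sum>x\<in>X. card {Q\<in>F. x \<in> Q})"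
    by (simp add: sum_distrib_left c_def)
  also have "(\<Sum>x\<in>X. card {Q\<in>F. x \<in> Q}) = r * card F"
    using F unif by (subst sum_card_containing[OF finF fin]) auto
  also have "C * K ^ (r - 1) * real (r * card F) \<le> C * K ^ (r - 1) * (real M * (C * K ^ r))"
    using r cardF assms unfolding of_nat_mult by (intro mult_left_mono mult_mono) auto
  also have "\<dots> = v"
  proof -
    have "2 * r - 1 = (r - 1) + r" using r by simp
    then show ?thesis by (simp add: v_def power2_eq_square power_add algebra_simps)
  qed
  finally have sumv: "(\<Sum>x\<in>X. (c x)\<^sup>2) \<le> v" .
  have "bexp q X (\<lambda>S. of_bool (\<bar>f S - bexp q X f\<bar> > K ^ r / sqrt (sqrt K)))
      \<le> 2 * exp (- ((K ^ r / sqrt (sqrt K))\<^sup>2 / (4 * v)))"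
    using \<open>K > 0\<close> by (intro bounded_differences_tail[OF fin q diff sumv v0]) auto
  also have "(K ^ r / sqrt (sqrt K))\<^sup>2 / (4 * v) = sqrt K / (4 * real M * C\<^sup>2)"
  proof -
    have "Suc (2 * r - 1) = r * 2" using r by simp
    then have "(K ^ r)\<^sup>2 = K ^ (2 * r - 1) * (sqrt K * sqrt K)"
      using \<open>K > 0\<close> by (metis less_imp_le power_Suc2 power_mult real_sqrt_mult_self abs_of_pos)
    then have "(K ^ r / sqrt (sqrt K))\<^sup>2 = K ^ (2 * r - 1) * sqrt K"
      using \<open>K > 0\<close> by (simp add: power_divide real_div_sqrt flip: times_divide_eq_right)
    then show ?thesis using \<open>K > 0\<close> by (simp add: v_def)
  qed
  finally show ?thesis unfolding Ef unfolding f_def .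
qed


text \<open>Event \<open>i\<close> is decided by the at most \<open>M * C * K ^ M\<close> points
  covered by \<open>F i\<close>, and each of them is covered by at most \<open>C * K ^ M\<close>
  families. The product bounds the dependence. The sizes of \<open>X\<close> and \<open>I\<close> do
  not occur, which is what frees the argument from \<open>n\<close>.\<close>

lemma thinning_step:
  fixes K C q :: real and F :: "'i \<Rightarrow> 'a set set" and r :: "'i \<Rightarrow> nat"
  assumes fin: "finite X" and q: "0 \<le> q" "q \<le> 1" and finI: "finite I"
    and F: "\<And>i. i \<in> I \<Longrightarrow> F i \<subseteq> Pow X"
    and unif: "\<And>i Q. i \<in> I \<Longrightarrow> Q \<in> F i \<Longrightarrow> card Q = r i"
    and r: "\<And>i. i \<in> I \<Longrightarrow> 1 \<le> r i \<and> r i \<le> M"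
    and cardF: "\<And>i. i \<in> I \<Longrightarrow> real (card (F i)) \<le> C * K ^ r i"
    and deg: "\<And>i y. i \<in> I \<Longrightarrow> y \<in> X \<Longrightarrow> real (card {Q\<in>F i. y \<in> Q}) \<le> C * K ^ (r i - 1)"
    and supp: "\<And>y. y \<in> X \<Longrightarrow> real (card {i\<in>I. y \<in> \<Union>(F i)}) \<le> C * K ^ M"
    and "C \<ge> 1" "K \<ge> 1" "M \<ge> 1"
    and large: "8 * exp (- (sqrt K / (4 * real M * C\<^sup>2))) * (real M * C\<^sup>2 * K ^ (2 * M)) \<le> 1"
  shows "\<exists>S\<subseteq>X. \<forall>i\<in>I. \<bar>real (card {Q\<in>F i. Q \<subseteq> S}) - q ^ r i * real (card (F i))\<bar> \<le> K ^ r i / sqrt (sqrt K)"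
proof -
  let ?p = "2 * exp (- (sqrt K / (4 * real M * C\<^sup>2)))"
  let ?D = "real M * C\<^sup>2 * K ^ (2 * M)"
  define B where "B i S \<longleftrightarrow>
    \<bar>real (card {Q\<in>F i. Q \<subseteq> S}) - q ^ r i * real (card (F i))\<bar> > K ^ r i / sqrt (sqrt K)" for i S
  have "\<exists>S\<subseteq>X. \<forall>i\<in>I. \<not> B i S"
  proof (rule local_lemma_bernoulli[OF fin q finI, where V = "\<lambda>i. \<Union>(F i)" and p = ?p and D = ?D])
    fix i S assume "i \<in> I"
    have "{Q\<in>F i. Q \<subseteq> S \<inter> \<Union>(F i)} = {Q\<in>F i. Q \<subseteq> S}" by auto
    then show "B i (S \<inter> \<Union>(F i)) = B i S" by (simp add: B_def)
  next
    fix i assume i: "i \<in> I"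
    show "bexp q X (\<lambda>S. of_bool (B i S)) \<le> ?p"
      unfolding B_def using i r[OF i] assms by (intro uniform_family_tail[OF fin q F[OF i]]) auto
    have UX: "\<Union>(F i) \<subseteq> X" using F[OF i] by auto
    have fU: "finite (\<Union>(F i))" by (rule finite_subset[OF UX fin])
    have "card (\<Union>(F i)) \<le> (\<Sum>Q\<in>F i. card Q)" by (rule card_Union_le_sum_card)
    also have "\<dots> = card (F i) * r i" using unif[OF i] by simp
    finally have "real (card (\<Union>(F i))) \<le> real (card (F i) * r i)" by (rule of_nat_mono)
    also have "\<dots> = real (card (F i)) * real (r i)" by simp
    also have "\<dots> \<le> (C * K ^ M) * real M"
    proof (rule mult_mono)
      have "C * K ^ r i \<le> C * K ^ M" using r[OF i] assms by (intro mult_left_mono power_increasing) auto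
      then show "real (card (F i)) \<le> C * K ^ M" using cardF[OF i] by linarith
    qed (use r[OF i] assms in auto)
    finally have cU: "real (card (\<Union>(F i))) \<le> C * K ^ M * real M" .
    have "{j\<in>I. \<Union>(F i) \<inter> \<Union>(F j) \<noteq> {}} \<subseteq> (\<Union>y\<in>\<Union>(F i). {j\<in>I. y \<in> \<Union>(F j)})" by blast
    then have "card {j\<in>I. \<Union>(F i) \<inter> \<Union>(F j) \<noteq> {}} \<le> card (\<Union>y\<in>\<Union>(F i). {j\<in>I. y \<in> \<Union>(F j)})"
      by (intro card_mono finite_UN_I fU finite_Collect_conjI disjI1) (use finI in simp_all)
    also have "\<dots> \<le> (\<Sum>y\<in>\<Union>(F i). card {j\<in>I. y \<in> \<Union>(F j)})" by (rule card_UN_le[OF fU])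
    finally have "real (card {j\<in>I. \<Union>(F i) \<inter> \<Union>(F j) \<noteq> {}}) \<le> real (\<Sum>y\<in>\<Union>(F i). card {j\<in>I. y \<in> \<Union>(F j)})"
      by (rule of_nat_mono)
    also have "\<dots> = (\<Sum>y\<in>\<Union>(F i). real (card {j\<in>I. y \<in> \<Union>(F j)}))" by (rule of_nat_sum)
    also have "\<dots> \<le> (\<Sum>y\<in>\<Union>(F i). C * K ^ M)" using supp UX by (intro sum_mono) blast
    also have "\<dots> = real (card (\<Union>(F i))) * (C * K ^ M)" by simp
    also have "\<dots> \<le> C * K ^ M * real M * (C * K ^ M)"
      using cU assms by (intro mult_right_mono) auto
    also have "\<dots> = ?D" by (simp add: power2_eq_square mult_2 power_add)
    finally show "real (card {j\<in>I. \<Union>(F i) \<inter> \<Union>(F j) \<noteq> {}}) \<le> ?D" .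
  next
    have "1 * 1 * 1 \<le> ?D" using assms by (intro mult_mono one_le_power) auto
    then show "1 \<le> ?D" by simp
    show "4 * ?p * ?D \<le> 1" using large by simp
  qed auto
  then show ?thesis by (simp add: B_def not_less)
qed

lemma eventually_thinning_large:
  fixes C :: real
  assumes "C \<ge> 1" "M \<ge> 1"
  shows "eventually (\<lambda>K. 8 * exp (- (sqrt K / (4 * real M * C\<^sup>2))) * (real M * C\<^sup>2 * K ^ (2 * M)) \<le> 1) at_top"
proof -
  define a where "a = 4 * real M * C\<^sup>2"
  define b where "b = real M * C\<^sup>2"
  define m where "m = 2 * M"
  have ab: "a > 0" "b > 0" using assms by (simp_all add: a_def b_def)
  have "((\<lambda>K. 8 * exp (- (sqrt K / a)) * (b * K ^ m)) \<longlongrightarrow> 0) at_top"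
    using ab by real_asymp
  then have "eventually (\<lambda>K. 8 * exp (- (sqrt K / a)) * (b * K ^ m) < 1) at_top"
    by (rule order_tendstoD) simp
  then show ?thesis unfolding a_def b_def m_def by eventually_elim simp
qed

subsection \<open>Sparsification of hypergraphs\<close>

definition codegree :: "'a set set \<Rightarrow> 'a set \<Rightarrow> 'a set \<Rightarrow> nat" where
  "codegree H S U = card {T\<in>H. U \<subseteq> T \<and> T \<subseteq> S}"

text \<open>The errors \<open>e\<close> are additive, relative to the powers of the current density parameter \<open>K\<close>.
  The value \<open>K0\<close> is the parameter of the whole vertex set \<open>X\<close>.\<close>

definition regular_subset ::
  "'a set \<Rightarrow> 'a set set \<Rightarrow> 'a set set \<Rightarrow> nat \<Rightarrow> (nat \<Rightarrow> real) \<Rightarrow> real \<Rightarrow> 'a set \<Rightarrow> real \<Rightarrow> real \<Rightarrow> bool" where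
  "regular_subset X H \<A> M \<beta> K0 S K e \<longleftrightarrow> S \<subseteq> X \<and>
    (\<forall>U\<subseteq>S. 1 \<le> card U \<and> card U < M \<longrightarrow>
       real (codegree H S U) \<le> (\<beta> (card U) + e) * K ^ (M - card U)) \<and>
    (\<forall>A\<in>\<A>. \<bar>real (card (S \<inter> A)) - real (card A) * K / K0\<bar> \<le> e * K)"

text \<open>One constant for all hypotheses of \<open>thinning_step\<close>. A vertex lies on at
  most \<open>(b + 1) * K ^ (M - 1)\<close> edges, each with \<open>2 ^ M\<close> subsets, and in at
  most \<open>D\<close> of the sets \<open>A\<close>; the final 2 covers
  \<open>card (S \<inter> A) \<le> 2 * K\<close>.\<close>

definition thinning_const :: "nat \<Rightarrow> real \<Rightarrow> nat \<Rightarrow> real" where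
  "thinning_const M b D = 2 ^ M * (b + 1) + D + 2"

text \<open>The bound \<open>b\<close> enters only the constants of the probabilistic estimates. The
  function \<beta> records the sharper factor for each size of \<open>U\<close>, so that a small
  factor for single vertices survives the descent even though larger sets only have a bounded
  one.\<close>

locale thinning_system =
  fixes X :: "'a set" and H \<A> :: "'a set set" and M D :: nat and \<beta> :: "nat \<Rightarrow> real" and b K0 :: real
  assumes finX: "finite X"
    and H: "\<And>T. T \<in> H \<Longrightarrow> T \<subseteq> X \<and> card T = M"
    and M: "2 \<le> M"
    and \<A>: "\<And>A. A \<in> \<A> \<Longrightarrow> A \<subseteq> X" "\<And>A. A \<in> \<A> \<Longrightarrow> real (card A) \<le> K0"
    and deg\<A>: "\<And>x. x \<in> X \<Longrightarrow> card {A\<in>\<A>. x \<in> A} \<le> D"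
    and \<beta>: "\<And>u. \<beta> u \<le> b" and b: "b \<ge> 0"
    and codeg: "\<And>U. U \<subseteq> X \<Longrightarrow> 1 \<le> card U \<Longrightarrow> card U < M \<Longrightarrow>
      real (codegree H X U) \<le> \<beta> (card U) * K0 ^ (M - card U)"
    and K0: "K0 \<ge> 1"
begin

abbreviation regular :: "'a set \<Rightarrow> real \<Rightarrow> real \<Rightarrow> bool" where
  "regular \<equiv> regular_subset X H \<A> M \<beta> K0"

lemma finH: "finite H"
  by (rule finite_subset[of _ "Pow X"]) (use H finX in auto)

lemma fin\<A>: "finite \<A>"
  by (rule finite_subset[of _ "Pow X"]) (use \<A> finX in auto)

lemma finT: "T \<in> H \<Longrightarrow> finite T"
  using H finX finite_subset by blast

lemma regular_mono:
  assumes "regular S K e" "e \<le> e'" "K \<ge> 0"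
  shows "regular S K e'"
  unfolding regular_subset_def
proof (intro conjI allI impI ballI)
  show "S \<subseteq> X" using assms(1) by (simp add: regular_subset_def)
  fix U assume U: "U \<subseteq> S" "1 \<le> card U \<and> card U < M"
  have "real (codegree H S U) \<le> (\<beta> (card U) + e) * K ^ (M - card U)"
    using assms(1) U by (simp add: regular_subset_def)
  also have "\<dots> \<le> (\<beta> (card U) + e') * K ^ (M - card U)"
    using assms by (intro mult_right_mono) auto
  finally show "real (codegree H S U) \<le> (\<beta> (card U) + e') * K ^ (M - card U)" .
next
  fix A assume "A \<in> \<A>"
  then have "\<bar>real (card (S \<inter> A)) - real (card A) * K / K0\<bar> \<le> e * K"
    using assms(1) by (simp add: regular_subset_def)
  also have "e * K \<le> e' * K" using assms by (intro mult_right_mono) auto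
  finally show "\<bar>real (card (S \<inter> A)) - real (card A) * K / K0\<bar> \<le> e' * K" .
qed

lemma regular_whole: "regular X K0 0"
  using codeg \<A> K0 by (auto simp: regular_subset_def Int_absorb1)

abbreviation C :: real where "C \<equiv> thinning_const M b D"

lemma C_ge: "C \<ge> 1" "C \<ge> b + 1" "C \<ge> 2"
proof -
  define z :: real where "z = 2 ^ M * (b + 1)"
  have "1 * (b + 1) \<le> z" unfolding z_def using b by (intro mult_right_mono) auto
  moreover have "C = z + real D + 2" by (simp only: thinning_const_def z_def)
  ultimately have "C \<ge> b + 3" by simp
  then show "C \<ge> 1" "C \<ge> b + 1" "C \<ge> 2" using b by simp_all
qed

text \<open>The system of codegree bounds closes under thinning: the degree of \<open>y\<close> in
  the family attached to \<open>U\<close> is the codegree of \<open>insert y U\<close>, which is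
  monitored too or is at most 1.\<close>

lemma regular_step:
  assumes S: "regular S K e" and e: "0 \<le> e" "e \<le> 1" and q: "1/2 \<le> q" "q \<le> 1" and K: "K \<ge> 1"
    and large: "8 * exp (- (sqrt K / (4 * real M * C\<^sup>2))) * (real M * C\<^sup>2 * K ^ (2 * M)) \<le> 1"
  shows "\<exists>S'. regular S' (q * K) (e + 2 ^ M / sqrt (sqrt K))"
proof -
  have SX: "S \<subseteq> X" and finS: "finite S" using S finX finite_subset by (auto simp: regular_subset_def)
  define Us where "Us = {U. U \<subseteq> S \<and> 1 \<le> card U \<and> card U < M}"
  have finUs: "finite Us" unfolding Us_def using finS by simp
  define HU where "HU U = {T\<in>H. U \<subseteq> T \<and> T \<subseteq> S}" for U
  have finHU: "finite (HU U)" for U unfolding HU_def using finH by simp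
  \<comment> \<open>The families consist of links \<open>T - U\<close> instead of edges: once
    \<open>U\<close> survives, only its other \<open>M - card U\<close> companions are random, so
    the expected factor is a power of \<open>q\<close> with this exponent. Counting
    \<open>S \<inter> A\<close> is put in the same form by singletons.\<close>
  define F where "F = case_sum (\<lambda>U. (\<lambda>T. T - U) ` HU U) (\<lambda>A. (\<lambda>y. {y}) ` (S \<inter> A))"
  define r where "r = case_sum (\<lambda>U::'a set. M - card U) (\<lambda>A::'a set. 1::nat)"
  have inj: "inj_on (\<lambda>T. T - U) (HU U)" for U by (rule inj_onI) (auto simp: HU_def)
  have card_image_HU: "card ((\<lambda>T. T - U) ` B) = card B" if "B \<subseteq> HU U" for U B
    using inj_on_subset[OF inj that] by (rule card_image)
  have bound: "real (codegree H S U) \<le> (b + 1) * K ^ (M - card U)" if "U \<subseteq> S" "1 \<le> card U" "card U < M" for U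
  proof -
    have "real (codegree H S U) \<le> (\<beta> (card U) + e) * K ^ (M - card U)"
      using S that by (simp add: regular_subset_def)
    also have "\<dots> \<le> (b + 1) * K ^ (M - card U)"
      using K e \<beta>[of "card U"] by (intro mult_right_mono) auto
    finally show ?thesis .
  qed
  have cardA: "real (card (S \<inter> A)) \<le> 2 * K" if A: "A \<in> \<A>" for A
  proof -
    have "real (card (S \<inter> A)) \<le> real (card A) * K / K0 + e * K"
      using S A unfolding regular_subset_def by fastforce
    moreover have "real (card A) * K / K0 \<le> K0 * K / K0"
      using \<A>(2)[OF A] K K0 by (intro divide_right_mono mult_right_mono) auto
    moreover have "e * K \<le> 1 * K" using e K by (intro mult_right_mono) auto
    ultimately show ?thesis using K0 by simp
  qed
  have "\<exists>S'\<subseteq>S. \<forall>i\<in>Us <+> \<A>. \<bar>real (card {Q\<in>F i. Q \<subseteq> S'}) - q ^ r i * real (card (F i))\<bar> \<le> K ^ r i / sqrt (sqrt K)"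
  proof (rule thinning_step[where M = M and C = C])
    fix i assume "i \<in> Us <+> \<A>"
    then consider U where "i = Inl U" "U \<in> Us" | A where "i = Inr A" "A \<in> \<A>" by blast
    note cases = this
    from cases show "F i \<subseteq> Pow S" by cases (auto simp: F_def HU_def)
    from cases show "1 \<le> r i \<and> r i \<le> M" using M by cases (auto simp: r_def Us_def)
    from cases show "card Q = r i" if "Q \<in> F i" for Q
    proof cases
      case 1
      then obtain T where T: "T \<in> HU U" "Q = T - U" using \<open>Q \<in> F i\<close> by (auto simp: F_def)
      then have "finite U" using 1 finS finite_subset by (auto simp: Us_def)
      then show ?thesis using T 1 H by (auto simp: HU_def r_def card_Diff_subset)
    next
      case 2
      then show ?thesis using that by (auto simp: F_def r_def)
    qed
    from cases show "real (card (F i)) \<le> C * K ^ r i"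
    proof cases
      case 1
      have "real (card (F i)) = real (codegree H S U)"
        using 1 by (simp add: F_def card_image_HU) (simp add: HU_def codegree_def)
      also have "\<dots> \<le> (b + 1) * K ^ (M - card U)" using 1 by (intro bound) (auto simp: Us_def)
      also have "\<dots> \<le> C * K ^ (M - card U)" using C_ge K by (intro mult_right_mono) auto
      finally show ?thesis using 1 by (simp add: r_def)
    next
      case 2
      have "real (card (F i)) = real (card (S \<inter> A))" using 2 by (simp add: F_def card_image)
      also have "\<dots> \<le> 2 * K" using 2 by (intro cardA)
      also have "\<dots> \<le> C * K" using C_ge K by (intro mult_right_mono) auto
      finally show ?thesis using 2 by (simp add: r_def)
    qed
    from cases show "real (card {Q\<in>F i. y \<in> Q}) \<le> C * K ^ (r i - 1)" if y: "y \<in> S" for y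
    proof cases
      case 1
      then have U: "U \<subseteq> S" "1 \<le> card U" "card U < M" "finite U" using finS finite_subset by (auto simp: Us_def)
      have C1: "1 \<le> C * K ^ (M - card U - 1)"
        using mult_mono[of 1 C 1 "K ^ (M - card U - 1)"] C_ge K by simp
      consider "y \<in> U" | "y \<notin> U" "card U + 1 < M" | "y \<notin> U" "card U + 1 = M" using U by linarith
      then show ?thesis
      proof cases
        case 1
        then have "{Q\<in>F i. y \<in> Q} = {}" using \<open>i = Inl U\<close> by (auto simp: F_def)
        then have "real (card {Q\<in>F i. y \<in> Q}) = 0" by (simp only: card.empty of_nat_0)
        then show ?thesis using C_ge K by simp
      next
        case 2
        have "{Q\<in>F i. y \<in> Q} = (\<lambda>T. T - U) ` {T\<in>H. insert y U \<subseteq> T \<and> T \<subseteq> S}"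
          using \<open>i = Inl U\<close> 2 by (auto simp: F_def HU_def)
        then have "card {Q\<in>F i. y \<in> Q} = codegree H S (insert y U)"
          by (simp add: codegree_def) (subst card_image_HU, auto simp: HU_def)
        moreover have "real (codegree H S (insert y U)) \<le> (b + 1) * K ^ (M - card (insert y U))"
          using 2 U y by (intro bound) auto
        moreover have "\<dots> \<le> C * K ^ (M - card (insert y U))" using C_ge K by (intro mult_right_mono) auto
        ultimately show ?thesis using \<open>i = Inl U\<close> 2 U by (simp add: r_def)
      next
        case 3
        \<comment> \<open>Here \<open>insert y U\<close> has the full size \<open>M\<close> and is
          not monitored, but the only edge that can contain it is itself.\<close>
        have "{Q\<in>F i. y \<in> Q} \<subseteq> {{y}}"
        proof
          fix Q assume "Q \<in> {Q\<in>F i. y \<in> Q}"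
          then obtain T where T: "T \<in> H" "U \<subseteq> T" "T \<subseteq> S" "Q = T - U" "y \<in> T"
            using \<open>i = Inl U\<close> by (auto simp: F_def HU_def)
          have "insert y U = T"
            using T 3 U H[of T] finite_subset[OF \<open>T \<subseteq> S\<close> finS] by (intro card_subset_eq) auto
          then show "Q \<in> {{y}}" using T 3 by auto
        qed
        then have "card {Q\<in>F i. y \<in> Q} \<le> card {{y}}" by (rule card_mono[rotated]) simp
        then show ?thesis using C1 \<open>i = Inl U\<close> by (simp add: r_def)
      qed
    next
      case 2
      have "{Q\<in>F i. y \<in> Q} \<subseteq> {{y}}" using 2 by (auto simp: F_def)
      then have "card {Q\<in>F i. y \<in> Q} \<le> card {{y}}" by (rule card_mono[rotated]) simp
      then show ?thesis using C_ge 2 by (simp add: r_def)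
    qed
  next
    fix y assume y: "y \<in> S"
    let ?HY = "{T\<in>H. {y} \<subseteq> T \<and> T \<subseteq> S}"
    \<comment> \<open>If \<open>y\<close> lies in a link of \<open>U\<close>, then \<open>U\<close>
      is a subset of an edge through \<open>y\<close>, so these \<open>U\<close> are counted by
      edges.\<close>
    have "{i \<in> Us <+> \<A>. y \<in> \<Union>(F i)} \<subseteq> (\<Union>T\<in>?HY. Pow T) <+> {A\<in>\<A>. y \<in> A}"
      by (auto simp: F_def HU_def)
    then have "card {i \<in> Us <+> \<A>. y \<in> \<Union>(F i)} \<le> card ((\<Union>T\<in>?HY. Pow T) <+> {A\<in>\<A>. y \<in> A})"
      using finH fin\<A> finT by (intro card_mono) auto
    also have "\<dots> = card (\<Union>T\<in>?HY. Pow T) + card {A\<in>\<A>. y \<in> A}"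
      using finH fin\<A> finT by (intro card_Plus) auto
    also have "card (\<Union>T\<in>?HY. Pow T) \<le> (\<Sum>T\<in>?HY. card (Pow T))" using finH by (intro card_UN_le) auto
    also have "\<dots> = codegree H S {y} * 2 ^ M"
      using H finT by (simp add: card_Pow codegree_def)
    finally have "card {i \<in> Us <+> \<A>. y \<in> \<Union>(F i)} \<le> codegree H S {y} * 2 ^ M + card {A\<in>\<A>. y \<in> A}"
      by simp
    then have "real (card {i \<in> Us <+> \<A>. y \<in> \<Union>(F i)})
        \<le> real (codegree H S {y} * 2 ^ M + card {A\<in>\<A>. y \<in> A})"
      by (rule of_nat_mono)
    also have "\<dots> = real (codegree H S {y}) * 2 ^ M + real (card {A\<in>\<A>. y \<in> A})" by simp
    also have "\<dots> \<le> ((b + 1) * K ^ (M - card {y})) * 2 ^ M + real D * 1"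
      using y M deg\<A>[of y] SX bound[of "{y}"] by (intro add_mono mult_right_mono) auto
    also have "\<dots> \<le> ((b + 1) * K ^ M) * 2 ^ M + real D * K ^ M"
      using b K by (intro add_mono mult_left_mono mult_right_mono power_increasing) auto
    also have "\<dots> \<le> C * K ^ M" using K by (simp add: thinning_const_def algebra_simps)
    finally show "real (card {i \<in> Us <+> \<A>. y \<in> \<Union>(F i)}) \<le> C * K ^ M" .
  qed (use finS finUs fin\<A> q C_ge K M large in auto)
  then obtain S' where S': "S' \<subseteq> S" and dev: "\<And>i. i \<in> Us <+> \<A> \<Longrightarrow>
      \<bar>real (card {Q\<in>F i. Q \<subseteq> S'}) - q ^ r i * real (card (F i))\<bar> \<le> K ^ r i / sqrt (sqrt K)"
    by blast
  \<comment> \<open>Rescaling an error from \<open>K\<close> to \<open>q * K\<close> costs at most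
    \<open>2 ^ m\<close>, because \<open>q\<close> is at least 1/2.\<close>
  have pow: "K ^ m / sqrt (sqrt K) \<le> 2 ^ M / sqrt (sqrt K) * (q * K) ^ m" if "m \<le> M" for m
  proof -
    have "1 \<le> (2 * q) ^ m" using q by (intro one_le_power) auto
    also have "\<dots> = 2 ^ m * q ^ m" by (simp add: power_mult_distrib)
    also have "\<dots> \<le> 2 ^ M * q ^ m" using that q by (intro mult_right_mono power_increasing) auto
    finally have "1 * (K ^ m / sqrt (sqrt K)) \<le> 2 ^ M * q ^ m * (K ^ m / sqrt (sqrt K))"
      using K by (intro mult_right_mono) auto
    then show ?thesis by (simp add: power_mult_distrib)
  qed
  have "regular S' (q * K) (e + 2 ^ M / sqrt (sqrt K))"
    unfolding regular_subset_def
  proof (intro conjI allI impI ballI)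
    show "S' \<subseteq> X" using S' SX by blast
    fix U assume U: "U \<subseteq> S'" "1 \<le> card U \<and> card U < M"
    then have UU: "U \<in> Us" using S' by (auto simp: Us_def)
    let ?m = "M - card U"
    have "{Q\<in>F (Inl U). Q \<subseteq> S'} = (\<lambda>T. T - U) ` {T\<in>H. U \<subseteq> T \<and> T \<subseteq> S'}"
      using U S' by (auto simp: F_def HU_def)
    then have 1: "card {Q\<in>F (Inl U). Q \<subseteq> S'} = codegree H S' U"
      by (simp add: codegree_def) (subst card_image_HU, use S' in \<open>auto simp: HU_def\<close>)
    have 2: "card (F (Inl U)) = codegree H S U"
      by (simp add: F_def card_image_HU) (simp add: HU_def codegree_def)
    have "real (codegree H S' U) \<le> q ^ ?m * real (codegree H S U) + K ^ ?m / sqrt (sqrt K)"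
      using dev[OF InlI[OF UU]] unfolding 1 2 by (simp add: r_def)
    also have "\<dots> \<le> q ^ ?m * ((\<beta> (card U) + e) * K ^ ?m) + 2 ^ M / sqrt (sqrt K) * (q * K) ^ ?m"
    proof (intro add_mono mult_left_mono)
      show "real (codegree H S U) \<le> (\<beta> (card U) + e) * K ^ ?m"
        using S U S' by (simp add: regular_subset_def)
    qed (use pow q in auto)
    also have "\<dots> = (\<beta> (card U) + (e + 2 ^ M / sqrt (sqrt K))) * (q * K) ^ ?m"
      by (simp add: power_mult_distrib algebra_simps)
    finally show "real (codegree H S' U) \<le> (\<beta> (card U) + (e + 2 ^ M / sqrt (sqrt K))) * (q * K) ^ ?m" .
  next
    fix A assume A: "A \<in> \<A>"
    have "{Q\<in>F (Inr A). Q \<subseteq> S'} = (\<lambda>y. {y}) ` (S' \<inter> A)" using S' by (auto simp: F_def)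
    then have 1: "card {Q\<in>F (Inr A). Q \<subseteq> S'} = card (S' \<inter> A)" by (simp add: card_image)
    have 2: "card (F (Inr A)) = card (S \<inter> A)" by (simp add: F_def card_image)
    have d: "\<bar>real (card (S' \<inter> A)) - q * real (card (S \<inter> A))\<bar> \<le> 2 ^ M / sqrt (sqrt K) * (q * K)"
      using dev[OF InrI[OF A]] pow[of 1] M unfolding 1 2 by (simp add: r_def)
    have "\<bar>real (card (S \<inter> A)) - real (card A) * K / K0\<bar> \<le> e * K"
      using S A by (simp add: regular_subset_def)
    then have "\<bar>q * (real (card (S \<inter> A)) - real (card A) * K / K0)\<bar> \<le> q * (e * K)"
      using q unfolding abs_mult by (intro mult_mono) auto
    moreover have "q * (real (card (S \<inter> A)) - real (card A) * K / K0)
        = q * real (card (S \<inter> A)) - real (card A) * (q * K) / K0" by (simp add: algebra_simps)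
    moreover have "\<bar>z - y\<bar> \<le> P + Q" if "\<bar>u\<bar> \<le> P" "u = x - y" "\<bar>z - x\<bar> \<le> Q" for u P x y z Q :: real
      using that by linarith
    ultimately have "\<bar>real (card (S' \<inter> A)) - real (card A) * (q * K) / K0\<bar>
        \<le> q * (e * K) + 2 ^ M / sqrt (sqrt K) * (q * K)" using d by blast
    also have "\<dots> = (e + 2 ^ M / sqrt (sqrt K)) * (q * K)" by (simp add: algebra_simps)
    finally show "\<bar>real (card (S' \<inter> A)) - real (card A) * (q * K) / K0\<bar> \<le> (e + 2 ^ M / sqrt (sqrt K)) * (q * K)" .
  qed
  then show ?thesis by blast
qed

text \<open>The accumulated error is kept in closed form. Halving adds \<open>2 ^ M\<close> over the
  fourth root of \<open>2 * k\<close> to six times this amount, and seven such terms fit into the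
  error allowed at \<open>k\<close> because \<open>7 \<le> 6 * sqrt (sqrt 2)\<close>; 6 is the least
  integer for which this works. The induction counts the halvings between \<open>K0\<close> and
  \<open>k\<close>.\<close>

lemma regular_iterate:
  assumes large: "\<And>K. K \<ge> k1 \<Longrightarrow> 8 * exp (- (sqrt K / (4 * real M * C\<^sup>2))) * (real M * C\<^sup>2 * K ^ (2 * M)) \<le> 1"
    and k1: "k1 \<ge> 1" "6 * 2 ^ M / sqrt (sqrt k1) \<le> 1"
    and k: "k1 \<le> k" "k \<le> K0"
  shows "\<exists>S. regular S k (6 * 2 ^ M / sqrt (sqrt k))"
proof -
  have "\<exists>S. regular S k (6 * 2 ^ M / sqrt (sqrt k))" if "k1 \<le> k" "k \<le> K0" "K0 \<le> 2 ^ j * k" for j :: nat and k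
    using that
  proof (induction j arbitrary: k)
    case 0
    then have "k = K0" by simp
    then show ?case using regular_mono[OF regular_whole, of "6 * 2 ^ M / sqrt (sqrt k)"] K0 by auto
  next
    case (Suc j)
    have kpos: "k \<ge> 1" using Suc.prems k1 by linarith
    show ?case
    proof (cases "2 * k \<le> K0")
      case True
      let ?e = "6 * 2 ^ M / sqrt (sqrt (2 * k))"
      obtain S where S: "regular S (2 * k) ?e" using Suc.IH[of "2 * k"] Suc.prems True k1 by auto
      have "?e \<le> 6 * 2 ^ M / sqrt (sqrt k1)"
        using Suc.prems k1 by (intro divide_left_mono) auto
      then have "?e \<le> 1" using k1 by linarith
      then have "\<exists>S'. regular S' (1/2 * (2 * k)) (?e + 2 ^ M / sqrt (sqrt (2 * k)))"
        using Suc.prems k1 by (intro regular_step[OF S] large) auto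
      then obtain S' where S': "regular S' k (?e + 2 ^ M / sqrt (sqrt (2 * k)))" by auto
      have "(7::real) \<le> 6 * sqrt (sqrt 2)"
      proof -
        have "(7/6::real) \<le> sqrt (sqrt 2)"
          by (intro real_le_rsqrt) (simp add: power2_eq_square)
        then show ?thesis by simp
      qed
      then have "7 * (2 ^ M / (sqrt (sqrt 2) * sqrt (sqrt k))) \<le> 6 * sqrt (sqrt 2) * (2 ^ M / (sqrt (sqrt 2) * sqrt (sqrt k)))"
        using kpos by (intro mult_right_mono) auto
      then have "?e + 2 ^ M / sqrt (sqrt (2 * k)) \<le> 6 * 2 ^ M / sqrt (sqrt k)"
        by (simp add: real_sqrt_mult mult.commute)
      then show ?thesis using regular_mono[OF S'] kpos by auto
    next
      case False
      \<comment> \<open>Less than one halving is left, so a single step with probability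
        \<open>k / K0\<close>, which is between 1/2 and 1, reaches \<open>k\<close> exactly.\<close>
      have "\<exists>S'. regular S' (k / K0 * K0) (0 + 2 ^ M / sqrt (sqrt K0))"
        using Suc.prems k1 False K0 by (intro regular_step[OF regular_whole] large) (auto simp: field_simps)
      then obtain S' where S': "regular S' k (2 ^ M / sqrt (sqrt K0))" using K0 by auto
      have "2 ^ M / sqrt (sqrt K0) \<le> 6 * 2 ^ M / sqrt (sqrt k)"
        using Suc.prems kpos by (intro frac_le) auto
      then show ?thesis using regular_mono[OF S'] kpos by auto
    qed
  qed
  moreover obtain j where "K0 < 2 ^ j" using real_arch_pow[of 2 K0] by auto
  moreover have "2 ^ j \<le> 2 ^ j * k" using k k1 by simp
  ultimately show ?thesis using k by (meson less_imp_le order_trans)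
qed

end

text \<open>The order of the quantifiers is the point: \<open>k1\<close> is fixed by
  \<open>b\<close>, \<open>e\<close>, \<open>M\<close> and \<open>D\<close> before the vertex set
  and its density \<open>K0\<close> are given.\<close>

lemma sparsification:
  fixes b e :: real and M D :: nat
  assumes b: "b \<ge> 0" and e: "e > 0" and M: "M \<ge> 2"
  shows "\<exists>k1\<ge>1. \<forall>(X :: 'a set) H \<A> \<beta> K0 k. thinning_system X H \<A> M D \<beta> b K0 \<longrightarrow> k1 \<le> k \<longrightarrow> k \<le> K0 \<longrightarrow>
    (\<exists>S. regular_subset X H \<A> M \<beta> K0 S k e)"
proof -
  define C where "C = thinning_const M b D"
  have C: "C \<ge> 1" using b by (simp add: C_def thinning_const_def add_increasing)
  have "((\<lambda>K. 6 * 2 ^ M / sqrt (sqrt K)) \<longlongrightarrow> 0) at_top" by real_asymp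
  then have "eventually (\<lambda>K. 6 * 2 ^ M / sqrt (sqrt K) < min 1 e) at_top"
    by (rule order_tendstoD) (use e in auto)
  moreover have "eventually (\<lambda>K. 8 * exp (- (sqrt K / (4 * real M * C\<^sup>2))) * (real M * C\<^sup>2 * K ^ (2 * M)) \<le> 1) at_top"
    using C M by (intro eventually_thinning_large) auto
  ultimately have "eventually (\<lambda>K::real. 6 * 2 ^ M / sqrt (sqrt K) < min 1 e \<and>
      8 * exp (- (sqrt K / (4 * real M * C\<^sup>2))) * (real M * C\<^sup>2 * K ^ (2 * M)) \<le> 1) at_top"
    by (rule eventually_conj)
  then obtain k0 where k0: "\<And>K. K \<ge> k0 \<Longrightarrow> 6 * 2 ^ M / sqrt (sqrt K) < min 1 e"
      "\<And>K. K \<ge> k0 \<Longrightarrow> 8 * exp (- (sqrt K / (4 * real M * C\<^sup>2))) * (real M * C\<^sup>2 * K ^ (2 * M)) \<le> 1"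
    unfolding eventually_at_top_linorder by blast
  define k1 where "k1 = max 1 k0"
  have "\<exists>S. regular_subset X H \<A> M \<beta> K0 S k e"
    if sys: "thinning_system X H \<A> M D \<beta> b K0" and k: "k1 \<le> k" "k \<le> K0"
    for X :: "'a set" and H \<A> \<beta> K0 k
  proof -
    interpret thinning_system X H \<A> M D \<beta> b K0 by (rule sys)
    have "\<exists>S. regular S k (6 * 2 ^ M / sqrt (sqrt k))"
    proof (rule regular_iterate[of k1])
      show "8 * exp (- (sqrt K / (4 * real M * (thinning_const M b D)\<^sup>2)))
          * (real M * (thinning_const M b D)\<^sup>2 * K ^ (2 * M)) \<le> 1" if "K \<ge> k1" for K
        using k0(2)[of K] that by (simp add: C_def k1_def)
      show "6 * 2 ^ M / sqrt (sqrt k1) \<le> 1" using k0(1)[of k1] by (simp add: k1_def)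
    qed (use k in \<open>auto simp: k1_def\<close>)
    then obtain S where S: "regular S k (6 * 2 ^ M / sqrt (sqrt k))" by blast
    have "regular S k e"
      using k0(1)[of k] k by (intro regular_mono[OF S]) (auto simp: k1_def)
    then show ?thesis by blast
  qed
  moreover have "k1 \<ge> 1" by (simp add: k1_def)
  ultimately show ?thesis by blast
qed

subsection \<open>Grid points on flats\<close>

lemma grid_coordE:
  assumes "x \<in> grid n"
  obtains a where "1 \<le> a" "a \<le> n" "x $ i = real a"
proof -
  have "\<exists>m\<in>{1..n}. x $ i = real m" using assms by (simp add: grid_def)
  then show thesis using that by auto
qed

text \<open>Gaussian elimination, pivoting on the largest coordinate of a vector of \<open>V\<close>.\<close>

lemma bounding_coordinates:
  fixes V :: "(real ^ 'd) set"
  assumes "subspace V" "dim V \<le> s"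
  shows "\<exists>I. card I \<le> s \<and> (\<forall>v\<in>V. \<forall>B\<ge>0. (\<forall>i\<in>I. \<bar>v $ i\<bar> \<le> B) \<longrightarrow> (\<forall>j. \<bar>v $ j\<bar> \<le> 3 ^ s * B))"
  using assms
proof (induction s arbitrary: V)
  case 0
  then have "V \<subseteq> {0}" by simp
  then show ?case by (intro exI[of _ "{}"]) auto
next
  case (Suc s)
  show ?case
  proof (cases "V \<subseteq> {0}")
    case True
    then show ?thesis by (intro exI[of _ "{}"]) auto
  next
    case False
    then obtain u where u: "u \<in> V" "u \<noteq> 0" by blast
    let ?m = "Max (range (\<lambda>j. \<bar>u $ j\<bar>))"
    have "?m \<in> range (\<lambda>j. \<bar>u $ j\<bar>)" by (intro Max_in) auto
    then have "\<exists>i. \<bar>u $ i\<bar> = ?m" by (simp only: image_iff) metis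
    then obtain i where i: "\<bar>u $ i\<bar> = ?m" ..
    have um: "\<bar>u $ j\<bar> \<le> \<bar>u $ i\<bar>" for j unfolding i by (intro Max_ge) auto
    have ui: "u $ i \<noteq> 0"
    proof
      assume "u $ i = 0"
      then have "u $ j = 0" for j using um[of j] by simp
      then show False using u(2) by (simp add: vec_eq_iff)
    qed
    define V' where "V' = {v\<in>V. v $ i = 0}"
    have sub: "subspace V'" using Suc.prems(1) by (auto simp: V'_def subspace_def)
    have "dim V' < dim V"
    proof (rule ccontr)
      assume "\<not> dim V' < dim V"
      then have "V' = V" using sub Suc.prems(1) by (intro subspace_dim_equal) (auto simp: V'_def)
      then show False using u(1) ui by (auto simp: V'_def)
    qed
    then have "dim V' \<le> s" using Suc.prems(2) by simp
    from Suc.IH[OF sub this] obtain I where I: "card I \<le> s"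
      "\<And>v B j. v \<in> V' \<Longrightarrow> B \<ge> 0 \<Longrightarrow> (\<And>i. i \<in> I \<Longrightarrow> \<bar>v $ i\<bar> \<le> B) \<Longrightarrow> \<bar>v $ j\<bar> \<le> 3 ^ s * B"
      by metis
    have "\<bar>v $ j\<bar> \<le> 3 ^ Suc s * B" if v: "v \<in> V" and B: "B \<ge> 0" "\<And>l. l \<in> insert i I \<Longrightarrow> \<bar>v $ l\<bar> \<le> B" for v B j
    proof -
      \<comment> \<open>Subtracting this multiple of \<open>u\<close> clears coordinate
        \<open>i\<close>. As \<open>i\<close> is a largest coordinate of \<open>u\<close>, every
        coordinate moves by at most \<open>B\<close>, which leads to
        \<open>2 * 3 ^ s + 1 \<le> 3 ^ Suc s\<close>.\<close>
      define c where "c = v $ i / u $ i"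
      have cu: "\<bar>c * u $ l\<bar> \<le> B" for l
      proof -
        have "\<bar>c * u $ l\<bar> = \<bar>v $ i\<bar> * (\<bar>u $ l\<bar> / \<bar>u $ i\<bar>)" by (simp add: c_def abs_mult)
        also have "\<dots> \<le> B * 1" using um[of l] ui B by (intro mult_mono) auto
        finally show ?thesis by simp
      qed
      have mem: "v - c *\<^sub>R u \<in> V'"
        using v u(1) Suc.prems(1) ui by (auto simp: V'_def c_def subspace_diff subspace_scale)
      have bd: "\<bar>(v - c *\<^sub>R u) $ l\<bar> \<le> 2 * B" if "l \<in> I" for l
        using cu[of l] B(2)[of l] that by auto
      have "\<bar>(v - c *\<^sub>R u) $ j\<bar> \<le> 3 ^ s * (2 * B)" by (rule I(2)[OF mem _ bd]) (use B(1) in simp_all)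
      then have "\<bar>v $ j\<bar> \<le> 3 ^ s * (2 * B) + B" using cu[of j] by auto
      also have "\<dots> \<le> 3 ^ s * (2 * B) + 3 ^ s * B"
        using B(1) mult_right_mono[of 1 "3 ^ s" B] by (simp add: mult.commute)
      finally show ?thesis by (simp add: algebra_simps)
    qed
    moreover have "card (insert i I) \<le> Suc s" using I(1) by (simp add: card_insert_if)
    ultimately show ?thesis by (intro exI[of _ "insert i I"]) auto
  qed
qed

text \<open>\<open>bounding_coordinates\<close> with \<open>B = 0\<close> says that at most
  \<open>s\<close> coordinates determine a vector of \<open>V\<close>, so restricting to them is
  injective on \<open>P\<close>.\<close>

lemma card_flat_le:
  fixes V P :: "(real ^ 'd) set" and Z :: "'d \<Rightarrow> real set"
  assumes V: "subspace V" "dim V \<le> s"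
    and P: "\<And>p p'. p \<in> P \<Longrightarrow> p' \<in> P \<Longrightarrow> p - p' \<in> V"
    and Z: "\<And>p i. p \<in> P \<Longrightarrow> p $ i \<in> Z i" "\<And>i. finite (Z i)" "\<And>i. card (Z i) \<le> w" and "1 \<le> w"
  shows "finite P" "card P \<le> w ^ s"
proof -
  obtain I where I: "card I \<le> s"
    "\<And>v B j. v \<in> V \<Longrightarrow> B \<ge> 0 \<Longrightarrow> (\<And>i. i \<in> I \<Longrightarrow> \<bar>v $ i\<bar> \<le> B) \<Longrightarrow> \<bar>v $ j\<bar> \<le> 3 ^ s * B"
    using bounding_coordinates[OF V] by metis
  let ?f = "\<lambda>p. restrict (vec_nth p) I"
  have inj: "inj_on ?f P"
  proof (rule inj_onI)
    fix p p' assume p: "p \<in> P" "p' \<in> P" and eq: "?f p = ?f p'"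
    have "\<bar>(p - p') $ j\<bar> \<le> 3 ^ s * 0" for j
    proof (rule I(2)[OF P[OF p]])
      fix i assume "i \<in> I"
      then have "p $ i = p' $ i" using fun_cong[OF eq, of i] by simp
      then show "\<bar>(p - p') $ i\<bar> \<le> 0" by simp
    qed simp
    then show "p = p'" by (simp add: vec_eq_iff)
  qed
  have im: "?f ` P \<subseteq> PiE I Z" using Z by (auto simp: PiE_def extensional_def)
  have finI: "finite I" by simp
  have fin: "finite (PiE I Z)" using Z by (intro finite_PiE) auto
  show "finite P" using finite_subset[OF im fin] inj by (rule finite_imageD)
  have "card P = card (?f ` P)" using inj by (simp add: card_image)
  also have "\<dots> \<le> card (PiE I Z)" by (rule card_mono[OF fin im])
  also have "\<dots> = (\<Prod>i\<in>I. card (Z i))" by (simp add: card_PiE)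
  also have "\<dots> \<le> (\<Prod>i\<in>I. w)" using Z by (intro prod_mono) auto
  also have "\<dots> = w ^ card I" by simp
  also have "\<dots> \<le> w ^ s" using I(1) \<open>1 \<le> w\<close> by (intro power_increasing) auto
  finally show "card P \<le> w ^ s" .
qed

definition lattice_box :: "nat \<Rightarrow> (real ^ 'd) set" where
  "lattice_box R = {v. \<forall>i. v $ i \<in> real_of_int ` {- int R..int R}}"

lemma finite_lattice_box: "finite (lattice_box R :: (real ^ 'd) set)"
  and card_lattice_box: "card (lattice_box R :: (real ^ 'd) set) \<le> (2 * R + 1) ^ CARD('d)"
proof -
  have c: "card (real_of_int ` {- int R..int R}) \<le> 2 * R + 1"
    by (rule order_trans[OF card_image_le]) simp_all
  have "finite (lattice_box R :: (real ^ 'd) set) \<and> card (lattice_box R :: (real ^ 'd) set) \<le> (2 * R + 1) ^ CARD('d)"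
    using c by (intro conjI card_flat_le[where V = UNIV and Z = "\<lambda>_. real_of_int ` {- int R..int R}"])
      (auto simp: lattice_box_def)
  then show "finite (lattice_box R :: (real ^ 'd) set)"
    "card (lattice_box R :: (real ^ 'd) set) \<le> (2 * R + 1) ^ CARD('d)" by blast+
qed

lemma grid_diff_lattice_box:
  assumes "x \<in> grid n" "y \<in> grid n" "\<And>i. \<bar>x $ i - y $ i\<bar> \<le> real R"
  shows "x - y \<in> lattice_box R"
  unfolding lattice_box_def
proof (intro CollectI allI)
  fix i
  obtain a b where ab: "x $ i = real a" "y $ i = real b"
    using grid_coordE[OF assms(1), of i] grid_coordE[OF assms(2), of i] by metis
  then have "(x - y) $ i = real_of_int (int a - int b)" by simp
  moreover have "\<bar>int a - int b\<bar> \<le> int R"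
    using assms(3)[of i] unfolding ab by linarith
  ultimately show "(x - y) $ i \<in> real_of_int ` {- int R..int R}" by (intro image_eqI[where x = "int a - int b"]) auto
qed

lemma grid_diff_lattice_box_self:
  assumes "x \<in> grid n" "y \<in> grid n"
  shows "x - y \<in> lattice_box n"
proof (rule grid_diff_lattice_box[OF assms])
  fix i
  obtain a b where "x $ i = real a" "y $ i = real b" "1 \<le> a" "a \<le> n" "1 \<le> b" "b \<le> n"
    using grid_coordE[OF assms(1), of i] grid_coordE[OF assms(2), of i] by metis
  then show "\<bar>x $ i - y $ i\<bar> \<le> real n" by auto
qed

lemma card_grid_flat_le:
  fixes V P :: "(real ^ 'd) set"
  assumes "subspace V" "dim V \<le> s" "P \<subseteq> grid n" "\<And>p p'. p \<in> P \<Longrightarrow> p' \<in> P \<Longrightarrow> p - p' \<in> V" "1 \<le> n"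
  shows "card P \<le> n ^ s"
proof (rule card_flat_le(2)[OF assms(1,2,4), where Z = "\<lambda>_. real ` {1..n}"])
  show "card (real ` {1..n}) \<le> n" by (rule order_trans[OF card_image_le]) simp_all
  fix p i assume "p \<in> P"
  then have "p \<in> grid n" using assms(3) by blast
  then obtain a where "1 \<le> a" "a \<le> n" "p $ i = real a" by (rule grid_coordE)
  then show "p $ i \<in> real ` {1..n}" by simp
qed (use assms in auto)

text \<open>Cover by cells of side \<open>m\<close>: points in a common cell differ by short lattice vectors, so if
  these span less than \<open>V\<close>, then a cell holds only \<open>O(m ^ (s - 1))\<close> points.\<close>

lemma spanned_or_sparse:
  fixes V P :: "(real ^ 'd) set"
  assumes V: "subspace V" "dim V = s" "1 \<le> s"
    and P: "P \<subseteq> grid n" "\<And>p p'. p \<in> P \<Longrightarrow> p' \<in> P \<Longrightarrow> p - p' \<in> V"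
    and m: "1 \<le> m" "m \<le> n"
    and not_spanned: "span (lattice_box (3 ^ s * m) \<inter> V) \<noteq> V"
  shows "real (card P) * real m \<le> 2 ^ s * (3 ^ (s + 1)) ^ (s - 1) * real n ^ s"
proof -
  define R where "R = 3 ^ s * m"
  define V0 where "V0 = span (lattice_box R \<inter> V)"
  have V0: "subspace V0" "V0 \<subseteq> V" "V0 \<noteq> V"
    using not_spanned V by (auto simp: V0_def R_def intro: span_minimal[THEN subsetD])
  have "\<not> dim V \<le> dim V0" using subspace_dim_equal[OF V0(1) V(1) V0(2)] V0(3) by blast
  then have dim0: "dim V0 \<le> s - 1" using V by simp
  have finP: "finite P" using P finite_grid finite_subset by blast
  obtain I where I: "card I \<le> s"
    "\<And>v B j. v \<in> V \<Longrightarrow> B \<ge> 0 \<Longrightarrow> (\<And>i. i \<in> I \<Longrightarrow> \<bar>v $ i\<bar> \<le> B) \<Longrightarrow> \<bar>v $ j\<bar> \<le> 3 ^ s * B"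
    using bounding_coordinates[of V s] V by (metis order_refl)
  \<comment> \<open>Cells use only the at most \<open>s\<close> coordinates in \<open>I\<close>, so
    their number is governed by the exponent \<open>s\<close> and not by the ambient dimension. The
    other coordinates within a cell are controlled by \<open>I\<close> up to the factor
    \<open>3 ^ s\<close>, whence the radius \<open>R\<close>.\<close>
  define \<phi> where "\<phi> p = restrict (\<lambda>i. nat \<lfloor>p $ i\<rfloor> div m) I" for p :: "real ^ 'd"
  have \<phi>P: "\<phi> ` P \<subseteq> PiE I (\<lambda>_. {0..n div m})"
  proof -
    have "nat \<lfloor>p $ i\<rfloor> div m \<le> n div m" if "p \<in> P" for p i
    proof -
      have "p \<in> grid n" using that P(1) by blast
      then obtain a where "a \<le> n" "p $ i = real a" by (rule grid_coordE)
      then show ?thesis by (simp add: div_le_mono)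
    qed
    then show ?thesis by (auto simp: \<phi>_def PiE_def extensional_def)
  qed
  have "card (\<phi> ` P) \<le> card (PiE I (\<lambda>_. {0..n div m}))"
    using \<phi>P by (intro card_mono finite_PiE) auto
  also have "\<dots> = (n div m + 1) ^ card I" by (simp add: card_PiE)
  also have "\<dots> \<le> (n div m + 1) ^ s" using I(1) by (intro power_increasing) auto
  finally have cells: "card (\<phi> ` P) \<le> (n div m + 1) ^ s" .
  have fiber: "card {p\<in>P. \<phi> p = c} \<le> (2 * R + 1) ^ (s - 1)" for c
  proof (cases "{p\<in>P. \<phi> p = c} = {}")
    case True
    then show ?thesis by (simp only: card.empty)
  next
    case False
    then obtain p0 where p0: "p0 \<in> P" "\<phi> p0 = c" by blast
    have box: "p - p' \<in> lattice_box R" if p: "p \<in> P" "p' \<in> P" "\<phi> p = c" "\<phi> p' = c" for p p'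
    proof (rule grid_diff_lattice_box)
      show "p \<in> grid n" "p' \<in> grid n" using p P by auto
      fix j
      have "\<bar>(p - p') $ j\<bar> \<le> 3 ^ s * real m"
      proof (rule I(2)[OF P(2)[OF p(1,2)]])
        fix i assume i: "i \<in> I"
        have "p \<in> grid n" "p' \<in> grid n" using p P(1) by auto
        then obtain a b where ab: "p $ i = real a" "p' $ i = real b" by (meson grid_coordE)
        have "\<phi> p i = \<phi> p' i" using p by simp
        then have eq: "a div m = b div m" using i by (simp add: \<phi>_def ab)
        have "a = m * (a div m) + a mod m" "b = m * (b div m) + b mod m" "m * (a div m) = m * (b div m)"
          by (simp, simp, simp only: eq)
        moreover have "a mod m < m" "b mod m < m" using m by simp_all
        ultimately have "a \<le> b + m \<and> b \<le> a + m" by linarith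
        then have "\<bar>real a - real b\<bar> \<le> real m" by linarith
        then show "\<bar>(p - p') $ i\<bar> \<le> real m" by (simp add: ab)
      qed simp
      then show "\<bar>p $ j - p' $ j\<bar> \<le> real R" by (simp add: R_def)
    qed
    show ?thesis
    proof (rule card_flat_le(2)[OF V0(1) dim0, where Z = "\<lambda>i. (\<lambda>z. p0 $ i + real_of_int z) ` {- int R..int R}"])
      show "card ((\<lambda>z. p0 $ i + real_of_int z) ` {- int R..int R}) \<le> 2 * R + 1" for i
        by (rule order_trans[OF card_image_le]) simp_all
      show "p - p' \<in> V0" if "p \<in> {p\<in>P. \<phi> p = c}" "p' \<in> {p\<in>P. \<phi> p = c}" for p p'
        unfolding V0_def using that box P(2) by (intro span_base) auto
      show "p $ i \<in> (\<lambda>z. p0 $ i + real_of_int z) ` {- int R..int R}" if "p \<in> {p\<in>P. \<phi> p = c}" for p i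
      proof -
        have "(p - p0) $ i \<in> real_of_int ` {- int R..int R}"
          using box[of p p0] that p0 by (simp add: lattice_box_def)
        then obtain z where "z \<in> {- int R..int R}" "p $ i - p0 $ i = real_of_int z" by auto
        then show ?thesis by (intro image_eqI[of _ _ z]) auto
      qed
    qed auto
  qed
  have "P = (\<Union>c\<in>\<phi> ` P. {p\<in>P. \<phi> p = c})" by auto
  then have "card P \<le> (\<Sum>c\<in>\<phi> ` P. card {p\<in>P. \<phi> p = c})"
    using card_UN_le[of "\<phi> ` P" "\<lambda>c. {p\<in>P. \<phi> p = c}"] finP by simp
  also have "\<dots> \<le> (\<Sum>c\<in>\<phi> ` P. (2 * R + 1) ^ (s - 1))" by (intro sum_mono fiber)
  also have "\<dots> \<le> (n div m + 1) ^ s * (2 * R + 1) ^ (s - 1)" using cells by simp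
  finally have "real (card P) \<le> real ((n div m + 1) ^ s * (2 * R + 1) ^ (s - 1))" by (rule of_nat_mono)
  also have "\<dots> = (real (n div m) + 1) ^ s * (2 * real R + 1) ^ (s - 1)" by (simp add: add.commute)
  also have "\<dots> \<le> (2 * real n / real m) ^ s * (3 ^ (s + 1) * real m) ^ (s - 1)"
  proof (intro mult_mono power_mono)
    have "real (n div m) \<le> real n / real m" by (rule of_nat_div_le_of_nat)
    moreover have "1 \<le> real n / real m" using m by simp
    ultimately show "real (n div m) + 1 \<le> 2 * real n / real m" by simp
    have "1 * 1 \<le> 3 ^ s * real m" using m by (intro mult_mono) auto
    then show "2 * real R + 1 \<le> 3 ^ (s + 1) * real m" by (simp add: R_def mult.commute)
  qed auto
  finally have "real (card P) * real m \<le> (2 * real n / real m) ^ s * (3 ^ (s + 1) * real m) ^ (s - 1) * real m"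
    by (rule mult_right_mono) simp
  also have "\<dots> = 2 ^ s * (3 ^ (s + 1)) ^ (s - 1) * real n ^ s"
  proof -
    have "real m ^ (s - 1) * real m = real m ^ s" using V(3) by (cases s) auto
    moreover have "(2 * real n / real m) ^ s * (3 ^ (s + 1) * real m) ^ (s - 1) * real m
        = 2 ^ s * (3 ^ (s + 1)) ^ (s - 1) * real n ^ s * (real m ^ (s - 1) * real m) / real m ^ s"
      by (simp only: power_mult_distrib power_divide) (simp only: ac_simps times_divide_eq_left times_divide_eq_right)
    ultimately show ?thesis using m by simp
  qed
  finally show ?thesis .
qed

section \<open>Flats through a fixed grid point\<close>

definition direction :: "real ^ 'd \<Rightarrow> (real ^ 'd) set \<Rightarrow> (real ^ 'd) set" where
  "direction x B = (\<lambda>p. p - x) ` B"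

definition spanned_flats :: "nat \<Rightarrow> nat \<Rightarrow> real ^ 'd \<Rightarrow> (real ^ 'd) set set" where
  "spanned_flats n s x = {B. affine B \<and> aff_dim B = int s \<and> x \<in> B \<and> affine hull (B \<inter> grid n) = B}"

lemma direction_subspace: "affine B \<Longrightarrow> x \<in> B \<Longrightarrow> subspace (direction x B)"
  unfolding direction_def by (rule affine_diffs_subspace_subtract)

lemma dim_direction:
  assumes "x \<in> B" "aff_dim B = int s"
  shows "dim (direction x B) = s"
  using aff_dim_eq_dim_subtract[of x B] assms hull_inc[of x B affine] by (simp add: direction_def)

lemma direction_diff:
  assumes "affine B" "x \<in> B" "p \<in> B" "p' \<in> B"
  shows "p - p' \<in> direction x B"
proof -
  have "(p - x) - (p' - x) \<in> direction x B"
    by (rule subspace_diff[OF direction_subspace[OF assms(1,2)]]) (use assms in \<open>auto simp: direction_def\<close>)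
  then show ?thesis by simp
qed

lemma inj_direction: "inj (direction x)"
proof (rule injI)
  fix B B' assume "direction x B = direction x B'"
  then have "(\<lambda>p. p + x) ` direction x B = (\<lambda>p. p + x) ` direction x B'" by simp
  then show "B = B'" by (simp add: direction_def image_image)
qed

lemma card_grid_affine_le:
  assumes "affine B" "aff_dim B \<le> int s" "1 \<le> n"
  shows "card (B \<inter> grid n) \<le> n ^ s"
proof (cases "B = {}")
  case False
  then obtain x where x: "x \<in> B" by blast
  have "int (dim (direction x B)) = aff_dim B"
    using aff_dim_eq_dim_subtract[of x B] x hull_inc[of x B affine] by (simp add: direction_def)
  then show ?thesis
    using assms x direction_diff[OF assms(1) x]
    by (intro card_grid_flat_le[OF direction_subspace[OF assms(1) x]]) auto
qed simp

lemma choose_le_power: "n choose s \<le> n ^ s"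
  by (cases "s \<le> n") (auto simp: binomial_le_pow binomial_eq_0)

text \<open>Such a space has a basis of \<open>s\<close> vectors from the box, so there are at most
  as many spaces as \<open>s\<close>-element subsets of the box.\<close>

lemma short_directions:
  fixes R s :: nat
  defines "\<V> \<equiv> {V :: (real ^ 'd) set. subspace V \<and> dim V = s \<and> span (lattice_box R \<inter> V) = V}"
  shows "finite \<V>" "card \<V> \<le> (2 * R + 1) ^ (CARD('d) * s)"
proof -
  let ?W = "{W :: (real ^ 'd) set. W \<subseteq> lattice_box R \<and> card W = s}"
  have fin: "finite ?W"
    by (rule finite_subset[of _ "Pow (lattice_box R)"]) (auto simp: finite_lattice_box)
  have sub: "\<V> \<subseteq> span ` ?W"
  proof
    fix V assume "V \<in> \<V>"
    then have V: "dim V = s" "span (lattice_box R \<inter> V) = V" by (auto simp: \<V>_def)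
    obtain W where W: "W \<subseteq> lattice_box R \<inter> V" "independent W" "lattice_box R \<inter> V \<subseteq> span W"
      "card W = dim (lattice_box R \<inter> V)" by (rule basis_exists)
    have "dim (lattice_box R \<inter> V) = dim V" using V(2) by (metis dim_span)
    moreover have "span W = V"
      using span_mono[OF W(1)] span_minimal[OF W(3) subspace_span] V(2) by (metis subset_antisym)
    ultimately show "V \<in> span ` ?W" using W V(1) by (intro image_eqI[of _ _ W]) auto
  qed
  show "finite \<V>" using finite_subset[OF sub] fin by blast
  have "card \<V> \<le> card (span ` ?W)" using sub fin by (intro card_mono) auto
  also have "\<dots> \<le> card ?W" using fin by (rule card_image_le)
  also have "\<dots> = card (lattice_box R :: (real ^ 'd) set) choose s"
    by (intro n_subsets finite_lattice_box)
  also have "\<dots> \<le> card (lattice_box R :: (real ^ 'd) set) ^ s" by (rule choose_le_power)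
  also have "\<dots> \<le> ((2 * R + 1) ^ CARD('d)) ^ s" by (intro power_mono card_lattice_box) simp
  finally show "card \<V> \<le> (2 * R + 1) ^ (CARD('d) * s)" by (simp add: power_mult)
qed

lemma flats_short_direction:
  fixes x :: "real ^ 'd"
  assumes "\<And>B. B \<in> \<B> \<Longrightarrow> affine B \<and> aff_dim B = int s \<and> x \<in> B \<and>
      span (lattice_box (3 ^ s * m) \<inter> direction x B) = direction x B" and "1 \<le> m"
  shows "finite \<B>" "card \<B> \<le> (3 ^ (s + 1) * m) ^ (CARD('d) * s)"
proof -
  let ?V = "{V :: (real ^ 'd) set. subspace V \<and> dim V = s \<and> span (lattice_box (3 ^ s * m) \<inter> V) = V}"
  have sub: "direction x ` \<B> \<subseteq> ?V"
  proof
    fix V assume "V \<in> direction x ` \<B>"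
    then obtain B where B: "B \<in> \<B>" "V = direction x B" by blast
    then show "V \<in> ?V"
      using assms(1)[OF B(1)] direction_subspace[of B x] dim_direction[of x B s] by simp
  qed
  have inj: "inj_on (direction x) \<B>" by (rule inj_on_subset[OF inj_direction]) simp
  have "finite (direction x ` \<B>)" using sub short_directions(1) by (rule finite_subset)
  then show "finite \<B>" using inj by (rule finite_imageD)
  have "card \<B> = card (direction x ` \<B>)" using inj by (simp add: card_image)
  also have "\<dots> \<le> card ?V" by (intro card_mono short_directions(1) sub)
  also have "\<dots> \<le> (2 * (3 ^ s * m) + 1) ^ (CARD('d) * s)" by (rule short_directions(2))
  also have "\<dots> \<le> (3 ^ (s + 1) * m) ^ (CARD('d) * s)"
  proof (rule power_mono)
    have "1 * 1 \<le> 3 ^ s * m" using assms(2) by (intro mult_mono) auto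
    then show "2 * (3 ^ s * m) + 1 \<le> 3 ^ (s + 1) * m" by (simp add: mult.commute)
  qed simp
  finally show "card \<B> \<le> (3 ^ (s + 1) * m) ^ (CARD('d) * s)" .
qed

text \<open>The constant of \<open>spanned_or_sparse\<close>: \<open>2 ^ s\<close> comes from the
  number of cells, the other factor from the points of one cell on a proper subspace.\<close>

definition sparse_const :: "nat \<Rightarrow> nat" where
  "sparse_const s = 2 ^ s * (3 ^ (s + 1)) ^ (s - 1)"

lemma sparse_const_pos: "1 \<le> sparse_const s"
proof -
  have "0 < sparse_const s" by (simp add: sparse_const_def)
  then show ?thesis by simp
qed

lemma flat_spanned_or_sparse:
  assumes "affine B" "aff_dim B = int s" "x \<in> B" "1 \<le> s" "1 \<le> m" "m \<le> n"
    and "span (lattice_box (3 ^ s * m) \<inter> direction x B) \<noteq> direction x B"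
  shows "card (B \<inter> grid n) * m \<le> sparse_const s * n ^ s"
proof -
  have "real (card (B \<inter> grid n)) * real m \<le> 2 ^ s * (3 ^ (s + 1)) ^ (s - 1) * real n ^ s"
    using assms direction_diff[OF assms(1,3)]
    by (intro spanned_or_sparse[OF direction_subspace dim_direction]) auto
  then have "real (card (B \<inter> grid n) * m) \<le> real (sparse_const s * n ^ s)"
    by (simp add: sparse_const_def)
  then show ?thesis by (rule of_nat_le_iff[THEN iffD1])
qed

text \<open>At a scale \<open>m\<close> beyond \<open>sparse_const s * L\<close>, sparseness
  contradicts having at least \<open>n ^ s / L\<close> grid points. So every rich flat through
  \<open>x\<close> has a direction spanned by vectors of a fixed box, and the count depends on
  \<open>m\<close> but not on \<open>n\<close>.\<close>

lemma rich_flats: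
  fixes x :: "real ^ 'd"
  assumes "1 \<le> s" "sparse_const s * L < m" "m \<le> n"
  defines "\<B> \<equiv> {B. affine B \<and> aff_dim B = int s \<and> x \<in> B \<and> n ^ s \<le> L * card (B \<inter> grid n)}"
  shows "finite \<B>" "card \<B> \<le> (3 ^ (s + 1) * m) ^ (CARD('d) * s)"
proof -
  have m: "1 \<le> m" using assms by simp
  have "affine B \<and> aff_dim B = int s \<and> x \<in> B \<and>
      span (lattice_box (3 ^ s * m) \<inter> direction x B) = direction x B" if "B \<in> \<B>" for B
  proof (rule ccontr)
    assume "\<not> ?thesis"
    then have "card (B \<inter> grid n) * m \<le> sparse_const s * n ^ s"
      using that assms m by (intro flat_spanned_or_sparse[of B s x]) (auto simp: \<B>_def)
    also have "\<dots> \<le> sparse_const s * (L * card (B \<inter> grid n))"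
      using that by (auto simp: \<B>_def)
    finally have le: "card (B \<inter> grid n) * m \<le> card (B \<inter> grid n) * (sparse_const s * L)"
      by (simp add: algebra_simps)
    have "0 < n ^ s" using m assms by simp
    also have "\<dots> \<le> L * card (B \<inter> grid n)" using that by (simp add: \<B>_def)
    finally have "0 < card (B \<inter> grid n)" by (simp add: zero_less_mult_iff)
    then have "m \<le> sparse_const s * L" using le by simp
    then show False using assms(2) by simp
  qed
  note short = this
  show "finite \<B>" by (rule flats_short_direction(1)[OF short m])
  show "card \<B> \<le> (3 ^ (s + 1) * m) ^ (CARD('d) * s)" by (rule flats_short_direction(2)[OF short m])
qed

lemma finite_spanned_flats: "finite (spanned_flats n s x)"
proof (rule finite_subset)
  show "spanned_flats n s x \<subseteq> (\<lambda>S. affine hull S) ` Pow (grid n)"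
  proof
    fix B assume "B \<in> spanned_flats n s x"
    then have "B = affine hull (B \<inter> grid n)" by (simp add: spanned_flats_def)
    then show "B \<in> (\<lambda>S. affine hull S) ` Pow (grid n)" by (rule image_eqI) simp
  qed
qed (simp add: finite_grid)

text \<open>Grid points differ by lattice vectors with entries of size at most \<open>n\<close>.
  Hence every spanned flat has some admissible scale, which makes the least one in
  \<open>sum_spanned_flats\<close> meaningful.\<close>

lemma spanned_flat_short:
  assumes "B \<in> spanned_flats n s x" "x \<in> grid n" "n \<le> R"
  shows "span (lattice_box R \<inter> direction x B) = direction x B"
proof
  have B: "affine B" "x \<in> B" "affine hull (B \<inter> grid n) = B" using assms by (auto simp: spanned_flats_def)
  let ?V = "direction x B" and ?W = "span (lattice_box R \<inter> direction x B)"
  show "?W \<subseteq> ?V" using direction_subspace[OF B(1,2)] by (intro span_minimal) auto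
  have "B \<inter> grid n \<subseteq> (+) x ` ?W"
  proof
    fix p assume p: "p \<in> B \<inter> grid n"
    have "p - x \<in> lattice_box n" using p assms(2) by (intro grid_diff_lattice_box_self) auto
    then have "p - x \<in> lattice_box R" using assms(3) by (fastforce simp: lattice_box_def)
    then have "p - x \<in> ?W" using p by (intro span_base) (auto simp: direction_def)
    then show "p \<in> (+) x ` ?W" by (metis add.commute diff_add_cancel image_eqI)
  qed
  then have "affine hull (B \<inter> grid n) \<subseteq> (+) x ` ?W"
    by (intro hull_minimal) (simp_all add: affine_translation[symmetric] subspace_imp_affine)
  then have "B \<subseteq> (+) x ` ?W" using B(3) by simp
  then show "?V \<subseteq> ?W" by (auto simp: direction_def)
qed

lemma sum_inverse_squares_le: "(\<Sum>j = 1..n. 1 / (real j)\<^sup>2) \<le> 2"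
proof -
  have "(\<Sum>j = 1..Suc n. 1 / (real j)\<^sup>2) \<le> 2 - 1 / real (Suc n)" for n
  proof (induction n)
    case (Suc n)
    have "1 / (real (Suc (Suc n)))\<^sup>2 \<le> 1 / (real (Suc n) * real (Suc (Suc n)))"
      unfolding power2_eq_square by (intro divide_left_mono mult_right_mono) auto
    also have "\<dots> = 1 / real (Suc n) - 1 / real (Suc (Suc n))"
      by (simp add: field_simps)
    finally show ?case using Suc by simp
  qed simp
  from this[of "n - 1"] show ?thesis by (cases n) (auto intro: order_trans)
qed

definition flat_sum_const :: "nat \<Rightarrow> nat \<Rightarrow> nat \<Rightarrow> real" where
  "flat_sum_const d s a = 2 * (2 * real (sparse_const s)) ^ a * (3 ^ (s + 1)) ^ (d * s)"

text \<open>Flats are grouped by the least scale \<open>j\<close> whose box spans their direction.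
  There are \<open>O(j ^ (d * s))\<close> flats in group \<open>j\<close>, and each has
  \<open>O(n ^ s / j)\<close> grid points since the previous scale does not span. The exponent
  \<open>a\<close> turns the sum over \<open>j\<close> into one dominated by inverse squares, whose
  bound 2 is the leading factor of \<open>flat_sum_const\<close>.\<close>

lemma sum_spanned_flats:
  fixes x :: "real ^ 'd"
  assumes x: "x \<in> grid n" and s: "1 \<le> s" and a: "CARD('d) * s + 2 \<le> a"
  shows "(\<Sum>B\<in>spanned_flats n s x. real (card (B \<inter> grid n)) ^ a)
    \<le> flat_sum_const CARD('d) s a * real n ^ (s * a)"
proof -
  let ?F = "spanned_flats n s x" and ?c = "real (sparse_const s)"
  have n: "1 \<le> n" using x grid_coordE[OF x] by (metis order_trans)
  define short where "short B m \<longleftrightarrow> 1 \<le> m \<and> span (lattice_box (3 ^ s * m) \<inter> direction x B) = direction x B" for B m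
  define \<mu> where "\<mu> B = (LEAST m. short B m)" for B
  have short_n: "short B n" if "B \<in> ?F" for B
    using that n x unfolding short_def by (intro conjI spanned_flat_short) auto
  have \<mu>: "short B (\<mu> B)" "\<mu> B \<le> n" if "B \<in> ?F" for B
    unfolding \<mu>_def using short_n[OF that] by (auto intro: LeastI Least_le)
  have size: "real (card (B \<inter> grid n)) \<le> 2 * ?c * real n ^ s / real (\<mu> B)" if B: "B \<in> ?F" for B
  proof (cases "\<mu> B = 1")
    case True
    have "card (B \<inter> grid n) \<le> n ^ s" using B n by (intro card_grid_affine_le) (auto simp: spanned_flats_def)
    also have "\<dots> \<le> 2 * sparse_const s * n ^ s" using sparse_const_pos[of s] by simp
    finally have "real (card (B \<inter> grid n)) \<le> real (2 * sparse_const s * n ^ s)" by (rule of_nat_mono)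
    then show ?thesis using True by simp
  next
    case False
    define m where "m = \<mu> B - 1"
    have m: "1 \<le> m" "m \<le> n" "\<mu> B = m + 1" using False \<mu>[OF B] by (auto simp: m_def short_def)
    \<comment> \<open>Minimality: the scale just below \<open>\<mu> B\<close> fails, so sparseness
      holds there. Going back from \<open>m\<close> to \<open>m + 1\<close> costs a factor
      2.\<close>
    have "\<not> short B m" unfolding \<mu>_def[symmetric] using m by (metis \<mu>_def less_add_one not_less_Least)
    then have "card (B \<inter> grid n) * m \<le> sparse_const s * n ^ s"
      using B s m by (intro flat_spanned_or_sparse[of B s x]) (auto simp: spanned_flats_def short_def)
    moreover have "card (B \<inter> grid n) * \<mu> B \<le> 2 * (card (B \<inter> grid n) * m)" using m by simp
    ultimately have "card (B \<inter> grid n) * \<mu> B \<le> 2 * (sparse_const s * n ^ s)" by linarith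
    then have "real (card (B \<inter> grid n) * \<mu> B) \<le> real (2 * (sparse_const s * n ^ s))" by (rule of_nat_mono)
    moreover have "0 < real (\<mu> B)" using m by simp
    ultimately show ?thesis by (simp add: pos_le_divide_eq mult.assoc)
  qed
  have count: "real (card {B\<in>?F. \<mu> B = j}) \<le> (3 ^ (s + 1)) ^ (CARD('d) * s) * real j ^ (CARD('d) * s)"
    if "1 \<le> j" for j
  proof -
    have "card {B\<in>?F. \<mu> B = j} \<le> (3 ^ (s + 1) * j) ^ (CARD('d) * s)"
      using \<mu>(1) that by (intro flats_short_direction(2)) (auto simp: spanned_flats_def short_def)
    then have "real (card {B\<in>?F. \<mu> B = j}) \<le> real ((3 ^ (s + 1) * j) ^ (CARD('d) * s))" by (rule of_nat_mono)
    then show ?thesis by (simp add: power_mult_distrib)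
  qed
  let ?A = "(2 * ?c * real n ^ s) ^ a" and ?b = "(3 ^ (s + 1)) ^ (CARD('d) * s) :: real"
  have "(\<Sum>B\<in>?F. real (card (B \<inter> grid n)) ^ a) \<le> (\<Sum>B\<in>?F. ?A / real (\<mu> B) ^ a)"
    unfolding power_divide [symmetric] by (intro sum_mono power_mono size) auto
  also have "\<dots> = (\<Sum>j = 1..n. \<Sum>B\<in>{B\<in>?F. \<mu> B = j}. ?A / real (\<mu> B) ^ a)"
    using \<mu> by (intro sum.group[symmetric]) (auto simp: finite_spanned_flats short_def)
  also have "\<dots> = (\<Sum>j = 1..n. real (card {B\<in>?F. \<mu> B = j}) * (?A / real j ^ a))"
    by (intro sum.cong) auto
  also have "\<dots> \<le> (\<Sum>j = 1..n. (?A * ?b) * (1 / (real j)\<^sup>2))"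
  proof (rule sum_mono)
    fix j assume j: "j \<in> {1..n}"
    have "real j ^ (CARD('d) * s) * (real j)\<^sup>2 \<le> real j ^ a"
      using j a unfolding power_add [symmetric] by (intro power_increasing) auto
    then have le: "real j ^ (CARD('d) * s) / real j ^ a \<le> 1 / (real j)\<^sup>2"
      using j by (simp add: field_simps)
    have "real (card {B\<in>?F. \<mu> B = j}) * (?A / real j ^ a) \<le> (?b * real j ^ (CARD('d) * s)) * (?A / real j ^ a)"
      using count[of j] j by (intro mult_right_mono) auto
    also have "\<dots> = (?A * ?b) * (real j ^ (CARD('d) * s) / real j ^ a)" by simp
    also have "\<dots> \<le> (?A * ?b) * (1 / (real j)\<^sup>2)" using le by (intro mult_left_mono) auto
    finally show "real (card {B\<in>?F. \<mu> B = j}) * (?A / real j ^ a) \<le> (?A * ?b) * (1 / (real j)\<^sup>2)" .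
  qed
  also have "\<dots> = (?A * ?b) * (\<Sum>j = 1..n. 1 / (real j)\<^sup>2)" by (simp only: sum_distrib_left)
  also have "\<dots> \<le> (?A * ?b) * 2" by (intro mult_left_mono sum_inverse_squares_le) auto
  also have "\<dots> = flat_sum_const CARD('d) s a * real n ^ (s * a)"
    by (simp add: flat_sum_const_def power_mult_distrib power_mult)
  finally show ?thesis .
qed

subsection \<open>Tuples in general position\<close>

text \<open>Tuples in general position are used because more than \<open>s\<close> of their points determine the flat;
  otherwise the codegree of a degenerate subset would exceed the power of \<open>n ^ t\<close> that is needed.
  Flats of dimension less than \<open>t\<close> are always treated as poor.\<close>

definition general_position :: "nat \<Rightarrow> (real ^ 'd) set \<Rightarrow> bool" where
  "general_position s T \<longleftrightarrow> (\<forall>W\<subseteq>T. card W \<le> s + 1 \<longrightarrow> \<not> affine_dependent W)"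

definition bad_tuples :: "nat \<Rightarrow> nat \<Rightarrow> nat \<Rightarrow> nat \<Rightarrow> (real ^ 'd) set set" where
  "bad_tuples n t M L = {T. T \<subseteq> grid n \<and> card T = M \<and>
     (\<exists>s\<in>{1..t}. aff_dim T = int s \<and> general_position s T \<and>
       (s = t \<longrightarrow> L * card (affine hull T \<inter> grid n) < n ^ t))}"

definition rich_sections :: "nat \<Rightarrow> nat \<Rightarrow> nat \<Rightarrow> (real ^ 'd) set set" where
  "rich_sections n t L = (\<lambda>B. B \<inter> grid n) `
     {B. affine B \<and> aff_dim B = int t \<and> n ^ t \<le> L * card (B \<inter> grid n)}"

section \<open>Upper bounds for codegrees of tuples\<close>

lemma card_supersets_le:
  assumes "finite Y" "finite U"
  shows "card {T. U \<subseteq> T \<and> T \<subseteq> Y \<and> card T = M} \<le> card Y ^ (M - card U)"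
proof -
  let ?T = "{T. U \<subseteq> T \<and> T \<subseteq> Y \<and> card T = M}" and ?W = "{W. W \<subseteq> Y \<and> card W = M - card U}"
  have "card ?T = card ((\<lambda>T. T - U) ` ?T)" by (rule card_image[symmetric]) (auto simp: inj_on_def)
  also have "\<dots> \<le> card ?W"
  proof (rule card_mono)
    show "finite ?W" using assms(1) by simp
    show "(\<lambda>T. T - U) ` ?T \<subseteq> ?W" using assms(2) by (auto simp: card_Diff_subset)
  qed
  also have "\<dots> = card Y choose (M - card U)" by (rule n_subsets[OF assms(1)])
  also have "\<dots> \<le> card Y ^ (M - card U)" by (rule choose_le_power)
  finally show ?thesis .
qed

lemma aff_dim_general_position:
  fixes U T :: "(real ^ 'd) set"
  assumes "general_position s T" "U \<subseteq> T" "s + 1 \<le> card U"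
  shows "int s \<le> aff_dim U"
proof -
  obtain W where W: "W \<subseteq> U" "card W = s + 1" using obtain_subset_with_card_n[OF assms(3)] by metis
  then have "\<not> affine_dependent W" using assms by (auto simp: general_position_def)
  then have "aff_dim W = int (card W) - 1" using aff_dim_affine_independent[of W] by simp
  then have "aff_dim W = int s" using W(2) by simp
  then show ?thesis using aff_dim_subset[OF W(1)] by simp
qed

lemma finite_bad_tuples: "finite (bad_tuples n t M L :: (real ^ 'd) set set)"
  by (rule finite_subset[of _ "Pow (grid n)"]) (auto simp: bad_tuples_def finite_grid)

text \<open>When \<open>U\<close> is too small to determine the flat, all spanned flats through one
  of its points are summed over. Of the \<open>M - card U\<close> remaining points, \<open>a\<close>
  pay for the convergence of this sum and the other \<open>r\<close> are bounded flat by flat by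
  \<open>c\<close>, where \<open>P\<close> can express poverty of the flat.\<close>

lemma bad_tuples_small_codegree:
  fixes x :: "real ^ 'd"
  assumes U: "U \<subseteq> grid n" "x \<in> U" "card U \<le> s" and s: "1 \<le> s" and a: "CARD('d) * s + 2 \<le> a"
    and M: "M = card U + a + r" and c: "\<And>B. P B \<Longrightarrow> real (card (B \<inter> grid n)) ^ r \<le> c" "c \<ge> 0"
  shows "real (card {T. T \<subseteq> grid n \<and> card T = M \<and> U \<subseteq> T \<and> aff_dim T = int s \<and> P (affine hull T)})
    \<le> flat_sum_const CARD('d) s a * real n ^ (s * a) * c"
proof -
  let ?T = "{T. T \<subseteq> grid n \<and> card T = M \<and> U \<subseteq> T \<and> aff_dim T = int s \<and> P (affine hull T)}"
  let ?F = "{B\<in>spanned_flats n s x. P B}"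
  have finU: "finite U" using U(1) finite_grid finite_subset by blast
  have finF: "finite ?F" using finite_spanned_flats[of n s x] by simp
  have finB: "finite (B \<inter> grid n)" for B :: "(real ^ 'd) set" using finite_grid by blast
  have "?T \<subseteq> (\<Union>B\<in>?F. {T. U \<subseteq> T \<and> T \<subseteq> B \<inter> grid n \<and> card T = M})"
  proof
    fix T assume T: "T \<in> ?T"
    let ?B = "affine hull T"
    have sub: "T \<subseteq> ?B \<inter> grid n" using T hull_subset by fastforce
    have "affine hull (?B \<inter> grid n) \<subseteq> ?B" by (rule hull_minimal) auto
    moreover have "?B \<subseteq> affine hull (?B \<inter> grid n)" by (rule hull_mono[OF sub])
    ultimately have "affine hull (?B \<inter> grid n) = ?B" by (rule subset_antisym)
    moreover have "x \<in> ?B" using T U(2) by (auto intro: hull_inc)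
    ultimately have "?B \<in> ?F" using T by (simp add: spanned_flats_def)
    then show "T \<in> (\<Union>B\<in>?F. {T. U \<subseteq> T \<and> T \<subseteq> B \<inter> grid n \<and> card T = M})"
      by (rule UN_I) (use T sub in simp)
  qed
  then have "card ?T \<le> card (\<Union>B\<in>?F. {T. U \<subseteq> T \<and> T \<subseteq> B \<inter> grid n \<and> card T = M})"
    by (rule card_mono[rotated])
      (intro finite_UN_I finF, rule finite_subset[of _ "Pow (grid n)"], auto simp: finite_grid)
  also have "\<dots> \<le> (\<Sum>B\<in>?F. card {T. U \<subseteq> T \<and> T \<subseteq> B \<inter> grid n \<and> card T = M})"
    by (rule card_UN_le[OF finF])
  also have "\<dots> \<le> (\<Sum>B\<in>?F. card (B \<inter> grid n) ^ (M - card U))"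
    by (intro sum_mono card_supersets_le finB finU)
  finally have "real (card ?T) \<le> real (\<Sum>B\<in>?F. card (B \<inter> grid n) ^ (M - card U))" by (rule of_nat_mono)
  also have "\<dots> = (\<Sum>B\<in>?F. real (card (B \<inter> grid n)) ^ a * real (card (B \<inter> grid n)) ^ r)"
    by (simp add: M power_add)
  also have "\<dots> \<le> (\<Sum>B\<in>?F. real (card (B \<inter> grid n)) ^ a * c)"
    by (intro sum_mono mult_left_mono c(1)) auto
  also have "\<dots> \<le> (\<Sum>B\<in>spanned_flats n s x. real (card (B \<inter> grid n)) ^ a * c)"
    using c(2) by (intro sum_mono2 finite_spanned_flats) auto
  also have "\<dots> = (\<Sum>B\<in>spanned_flats n s x. real (card (B \<inter> grid n)) ^ a) * c"
    by (simp only: sum_distrib_right)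
  also have "\<dots> \<le> flat_sum_const CARD('d) s a * real n ^ (s * a) * c"
    using U s a c(2) by (intro mult_right_mono sum_spanned_flats) auto
  finally show ?thesis .
qed

text \<open>More than \<open>s\<close> points in general position already span the flat, so every
  counted tuple lies in \<open>affine hull U\<close>.\<close>

lemma bad_tuples_large_codegree:
  fixes U :: "(real ^ 'd) set"
  assumes U: "U \<subseteq> grid n" "s + 1 \<le> card U" and n: "1 \<le> n"
  shows "card {T. T \<subseteq> grid n \<and> card T = M \<and> U \<subseteq> T \<and> aff_dim T = int s \<and> general_position s T}
    \<le> (n ^ s) ^ (M - card U)"
proof (cases "{T. T \<subseteq> grid n \<and> card T = M \<and> U \<subseteq> T \<and> aff_dim T = int s \<and> general_position s T} = {}")
  case True
  then show ?thesis by (simp only: card.empty)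
next
  case False
  let ?T = "{T. T \<subseteq> grid n \<and> card T = M \<and> U \<subseteq> T \<and> aff_dim T = int s \<and> general_position s T}"
  let ?Y = "affine hull U \<inter> grid n"
  have finU: "finite U" using U(1) finite_grid finite_subset by blast
  have U0: "U \<noteq> {}" using U(2) by auto
  have dimU: "aff_dim U = int s" and hull: "T \<subseteq> affine hull U" if T: "T \<in> ?T" for T
  proof -
    have "int s \<le> aff_dim U" using T U(2) aff_dim_general_position[of s T U] by auto
    moreover have "aff_dim U \<le> aff_dim T" using T by (intro aff_dim_subset) auto
    ultimately show d: "aff_dim U = int s" using T by simp
    have "affine hull U = affine hull T"
      using T U0 d by (intro affine_dim_equal hull_mono) auto
    then show "T \<subseteq> affine hull U" using hull_subset[of T affine] by simp
  qed
  have "?T \<subseteq> {T. U \<subseteq> T \<and> T \<subseteq> ?Y \<and> card T = M}" using hull by auto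
  then have "card ?T \<le> card {T. U \<subseteq> T \<and> T \<subseteq> ?Y \<and> card T = M}"
    by (rule card_mono[rotated]) (rule finite_subset[of _ "Pow (grid n)"], auto simp: finite_grid)
  also have "\<dots> \<le> card ?Y ^ (M - card U)" by (intro card_supersets_le finU) (simp add: finite_grid)
  also have "\<dots> \<le> (n ^ s) ^ (M - card U)"
    using False dimU n by (intro power_mono card_grid_affine_le) (auto simp: affine_affine_hull)
  finally show ?thesis .
qed

text \<open>The exponent \<open>d * d + 2\<close> makes the sum over all flats through a point converge. The size leaves
  this exponent after removing up to \<open>d\<close> points, and one point removed leaves \<open>d\<close> further factors,
  which provide the gain \<open>1 / L\<close> in the vertex degrees.\<close>

definition tuple_exponent :: "nat \<Rightarrow> nat" where "tuple_exponent d = d * d + 2"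

definition tuple_size :: "nat \<Rightarrow> nat" where "tuple_size d = tuple_exponent d + d + 1"

text \<open>The dimensions of the spanned flats are summed. The summand 1 pays for sets
  \<open>U\<close> that already span the flat, where the codegree is at most a pure power.\<close>

definition codegree_const :: "nat \<Rightarrow> real" where
  "codegree_const d = (\<Sum>s = 1..d. flat_sum_const d s (tuple_exponent d) + 1)"

lemma flat_sum_const_nonneg: "0 \<le> flat_sum_const d s a"
  by (simp add: flat_sum_const_def)

lemma codegree_const_nonneg: "0 \<le> codegree_const d"
  unfolding codegree_const_def by (intro sum_nonneg) (simp add: flat_sum_const_nonneg)

lemma bad_tuples_codegree_by_dim:
  fixes U :: "(real ^ 'd) set"
  assumes "codegree (bad_tuples n t M L) (grid n) U = m"
    and "\<And>s. 1 \<le> s \<Longrightarrow> s \<le> t \<Longrightarrow>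
      real (card {T. T \<subseteq> grid n \<and> card T = M \<and> U \<subseteq> T \<and> aff_dim T = int s \<and> general_position s T \<and>
        (s = t \<longrightarrow> L * card (affine hull T \<inter> grid n) < n ^ t)}) \<le> (flat_sum_const CARD('d) s a + 1) * c"
    and "t \<le> CARD('d)" "0 \<le> c" "a = tuple_exponent CARD('d)"
  shows "real m \<le> codegree_const CARD('d) * c"
proof -
  let ?T = "\<lambda>s. {T. T \<subseteq> grid n \<and> card T = M \<and> U \<subseteq> T \<and> aff_dim T = int s \<and> general_position s T \<and>
        (s = t \<longrightarrow> L * card (affine hull T \<inter> grid n) < n ^ t)}"
  have fin: "finite (?T s)" for s by (rule finite_subset[of _ "Pow (grid n)"]) (auto simp: finite_grid)
  have "m = card {T \<in> bad_tuples n t M L. U \<subseteq> T \<and> T \<subseteq> grid n}"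
    using assms(1) by (simp add: codegree_def)
  also have "\<dots> \<le> card (\<Union>s\<in>{1..t}. ?T s)"
    by (rule card_mono) (intro finite_UN_I fin finite_atLeastAtMost, auto simp: bad_tuples_def)
  also have "\<dots> \<le> (\<Sum>s\<in>{1..t}. card (?T s))" by (rule card_UN_le) simp
  finally have "real m \<le> real (\<Sum>s\<in>{1..t}. card (?T s))" by (rule of_nat_mono)
  also have "\<dots> = (\<Sum>s\<in>{1..t}. real (card (?T s)))" by (rule of_nat_sum)
  also have "\<dots> \<le> (\<Sum>s\<in>{1..t}. (flat_sum_const CARD('d) s a + 1) * c)"
    by (rule sum_mono) (use assms(2) in auto)
  also have "\<dots> \<le> (\<Sum>s\<in>{1..CARD('d)}. (flat_sum_const CARD('d) s a + 1) * c)"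
    using assms(3,4) flat_sum_const_nonneg by (intro sum_mono2) auto
  also have "\<dots> = codegree_const CARD('d) * c"
    by (simp only: codegree_const_def assms(5) sum_distrib_right)
  finally show ?thesis .
qed

lemma bad_tuples_codegree:
  fixes U :: "(real ^ 'd) set"
  assumes U: "U \<subseteq> grid n" "1 \<le> card U" and t: "1 \<le> t" "t \<le> CARD('d)" and n: "1 \<le> n"
    and M: "M = tuple_size CARD('d)"
  shows "real (codegree (bad_tuples n t M L) (grid n) U)
    \<le> codegree_const CARD('d) * (real n ^ t) ^ (M - card U)"
proof (rule bad_tuples_codegree_by_dim[OF refl _ t(2) _ refl])
  fix s assume s: "1 \<le> s" "s \<le> t"
  let ?a = "tuple_exponent CARD('d)"
  let ?T = "{T. T \<subseteq> grid n \<and> card T = M \<and> U \<subseteq> T \<and> aff_dim T = int s \<and> general_position s T \<and>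
        (s = t \<longrightarrow> L * card (affine hull T \<inter> grid n) < n ^ t)}"
  have st: "(real n ^ s) ^ (M - card U) \<le> (real n ^ t) ^ (M - card U)"
    using s n by (intro power_mono power_increasing) auto
  have fin: "finite {T. T \<subseteq> grid n \<and> Q T}" for Q :: "(real ^ 'd) set \<Rightarrow> bool"
    by (rule finite_subset[of _ "Pow (grid n)"]) (auto simp: finite_grid)
  show "real (card ?T) \<le> (flat_sum_const CARD('d) s ?a + 1) * (real n ^ t) ^ (M - card U)"
  proof (cases "card U \<le> s")
    case True
    define r where "r = M - card U - ?a"
    obtain x where x: "x \<in> U" using U(2) by fastforce
    \<comment> \<open>Since \<open>card U \<le> s \<le> CARD('d)\<close>, the tuple size leaves more
      than \<open>?a\<close> points outside \<open>U\<close>.\<close>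
    have Mr: "M = card U + ?a + r" using True s t by (simp add: r_def M tuple_size_def)
    have "CARD('d) * s + 2 \<le> ?a" using s t by (simp add: tuple_exponent_def)
    moreover have "real (card (B \<inter> grid n)) ^ r \<le> (real n ^ s) ^ r"
      if "affine B \<and> aff_dim B = int s" for B :: "(real ^ 'd) set"
    proof (rule power_mono)
      have "card (B \<inter> grid n) \<le> n ^ s" using that n by (intro card_grid_affine_le) auto
      then show "real (card (B \<inter> grid n)) \<le> real n ^ s" by (metis of_nat_le_iff of_nat_power)
    qed simp
    ultimately have "real (card {T. T \<subseteq> grid n \<and> card T = M \<and> U \<subseteq> T \<and> aff_dim T = int s \<and>
        (affine (affine hull T) \<and> aff_dim (affine hull T) = int s)})
      \<le> flat_sum_const CARD('d) s ?a * real n ^ (s * ?a) * (real n ^ s) ^ r"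
      using U x True s Mr by (intro bad_tuples_small_codegree) auto
    moreover have "card ?T \<le> card {T. T \<subseteq> grid n \<and> card T = M \<and> U \<subseteq> T \<and> aff_dim T = int s \<and>
        (affine (affine hull T) \<and> aff_dim (affine hull T) = int s)}"
      by (intro card_mono fin) auto
    moreover have "real n ^ (s * ?a) * (real n ^ s) ^ r = (real n ^ s) ^ (M - card U)"
      by (simp add: Mr power_mult power_add)
    ultimately have "real (card ?T) \<le> flat_sum_const CARD('d) s ?a * (real n ^ s) ^ (M - card U)"
      by (simp add: mult.assoc)
    also have "\<dots> \<le> (flat_sum_const CARD('d) s ?a + 1) * (real n ^ t) ^ (M - card U)"
      using st flat_sum_const_nonneg by (intro mult_mono) auto
    finally show ?thesis .
  next
    case False
    have "card ?T \<le> card {T. T \<subseteq> grid n \<and> card T = M \<and> U \<subseteq> T \<and> aff_dim T = int s \<and> general_position s T}"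
      by (intro card_mono fin) auto
    also have "\<dots> \<le> (n ^ s) ^ (M - card U)"
      using False U n by (intro bad_tuples_large_codegree) auto
    finally have "real (card ?T) \<le> real ((n ^ s) ^ (M - card U))" by (rule of_nat_mono)
    also have "\<dots> \<le> 1 * (real n ^ t) ^ (M - card U)" using st by simp
    also have "\<dots> \<le> (flat_sum_const CARD('d) s ?a + 1) * (real n ^ t) ^ (M - card U)"
      using flat_sum_const_nonneg by (intro mult_right_mono) auto
    finally show ?thesis .
  qed
qed simp

lemma bad_tuples_degree:
  fixes x :: "real ^ 'd"
  assumes x: "x \<in> grid n" and t: "1 \<le> t" "t \<le> CARD('d)" and n: "L \<le> n" "1 \<le> L"
    and M: "M = tuple_size CARD('d)"
  shows "real (codegree (bad_tuples n t M L) (grid n) {x})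
    \<le> codegree_const CARD('d) / real L * (real n ^ t) ^ (M - 1)"
proof -
  let ?a = "tuple_exponent CARD('d)" and ?d = "CARD('d)"
  have Mr: "M = card {x} + ?a + ?d" "M - 1 = ?a + ?d" by (simp_all add: M tuple_size_def)
  have d: "1 \<le> ?d" by simp
  have fin: "finite {T. T \<subseteq> grid n \<and> Q T}" for Q :: "(real ^ 'd) set \<Rightarrow> bool"
    by (rule finite_subset[of _ "Pow (grid n)"]) (auto simp: finite_grid)
  have "real (codegree (bad_tuples n t M L) (grid n) {x})
    \<le> codegree_const CARD('d) * ((real n ^ t) ^ (M - 1) / real L)"
  proof (rule bad_tuples_codegree_by_dim[OF refl _ t(2) _ refl])
    fix s assume s: "1 \<le> s" "s \<le> t"
    let ?T = "{T. T \<subseteq> grid n \<and> card T = M \<and> {x} \<subseteq> T \<and> aff_dim T = int s \<and> general_position s T \<and>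
          (s = t \<longrightarrow> L * card (affine hull T \<inter> grid n) < n ^ t)}"
    define P where "P B \<longleftrightarrow> affine B \<and> aff_dim B = int s \<and> (s = t \<longrightarrow> L * card (B \<inter> grid n) < n ^ t)"
      for B :: "(real ^ 'd) set"
    have a: "?d * s + 2 \<le> ?a" using s t by (simp add: tuple_exponent_def)
    have c: "real (card (B \<inter> grid n)) ^ ?d \<le> (real n ^ t) ^ ?d / real L" if B: "P B" for B
    proof -
      have le: "card (B \<inter> grid n) * L \<le> n ^ t"
      proof (cases "s = t")
        case True
        then show ?thesis using B by (simp add: P_def mult.commute)
      next
        case False
        \<comment> \<open>A flat of smaller dimension is poor for free: it loses a factor
          \<open>n\<close>, which is at least \<open>L\<close>.\<close>
        have "card (B \<inter> grid n) * L \<le> n ^ s * n"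
          using B n by (intro mult_mono card_grid_affine_le) (auto simp: P_def)
        also have "\<dots> = n ^ Suc s" by simp
        also have "\<dots> \<le> n ^ t" using False s n by (intro power_increasing) auto
        finally show ?thesis .
      qed
      have "(card (B \<inter> grid n)) ^ ?d * L \<le> card (B \<inter> grid n) ^ ?d * L ^ ?d"
        using n by (intro mult_left_mono self_le_power) auto
      also have "\<dots> = (card (B \<inter> grid n) * L) ^ ?d" by (simp add: power_mult_distrib)
      also have "\<dots> \<le> (n ^ t) ^ ?d" by (intro power_mono le) simp
      finally have "real (card (B \<inter> grid n) ^ ?d * L) \<le> real ((n ^ t) ^ ?d)" by (rule of_nat_mono)
      then show ?thesis using n by (simp add: pos_le_divide_eq)
    qed
    have "real (card {T. T \<subseteq> grid n \<and> card T = M \<and> {x} \<subseteq> T \<and> aff_dim T = int s \<and> P (affine hull T)})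
      \<le> flat_sum_const ?d s ?a * real n ^ (s * ?a) * ((real n ^ t) ^ ?d / real L)"
      by (rule bad_tuples_small_codegree[OF _ _ _ s(1) a Mr(1) c]) (use x s n in auto)
    moreover have "card ?T \<le> card {T. T \<subseteq> grid n \<and> card T = M \<and> {x} \<subseteq> T \<and> aff_dim T = int s \<and> P (affine hull T)}"
      by (intro card_mono fin) (auto simp: P_def)
    ultimately have "real (card ?T) \<le> flat_sum_const ?d s ?a * (real n ^ (s * ?a) * ((real n ^ t) ^ ?d / real L))"
      by (simp add: mult.assoc)
    also have "\<dots> \<le> (flat_sum_const ?d s ?a + 1) * (real n ^ (t * ?a) * ((real n ^ t) ^ ?d / real L))"
      using s n flat_sum_const_nonneg by (intro mult_mono power_increasing) auto
    also have "real n ^ (t * ?a) * ((real n ^ t) ^ ?d / real L) = (real n ^ t) ^ (M - 1) / real L"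
      unfolding Mr(2) by (simp add: power_mult power_add)
    finally show "real (card ?T) \<le> (flat_sum_const ?d s ?a + 1) * ((real n ^ t) ^ (M - 1) / real L)" .
  qed simp
  then show ?thesis by simp
qed

text \<open>The initial density \<open>n ^ t\<close> is the maximal number of grid points on a
  \<open>t\<close>-flat. \<open>D\<close> is the bound of \<open>rich_flats\<close> at the smallest
  admissible scale and is independent of \<open>n\<close>.\<close>

lemma grid_thinning_system:
  assumes t: "1 \<le> t" "t \<le> CARD('d)" and L: "1 \<le> L" and n: "sparse_const t * L + 1 \<le> n"
    and M: "M = tuple_size CARD('d)"
    and D: "D = (3 ^ (t + 1) * (sparse_const t * L + 1)) ^ (CARD('d) * t)"
    and b: "b = codegree_const CARD('d)"
  shows "thinning_system (grid n :: (real ^ 'd) set) (bad_tuples n t M L) (rich_sections n t L) M D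
    (\<lambda>u. if u = 1 then b / real L else b) b (real n ^ t)"
proof
  have "1 * L \<le> sparse_const t * L" by (intro mult_right_mono sparse_const_pos) simp
  then have Ln: "L \<le> n" using n by linarith
  have n1: "1 \<le> n" using n by linarith
  have b0: "0 \<le> b" by (simp add: b codegree_const_nonneg)
  show "finite (grid n :: (real ^ 'd) set)" by (rule finite_grid)
  show "T \<subseteq> grid n \<and> card T = M" if "T \<in> bad_tuples n t M L" for T :: "(real ^ 'd) set"
    using that by (simp add: bad_tuples_def)
  show "2 \<le> M" by (simp add: M tuple_size_def tuple_exponent_def)
  show "A \<subseteq> grid n" if "A \<in> rich_sections n t L" for A :: "(real ^ 'd) set"
    using that by (auto simp: rich_sections_def)
  show "real (card A) \<le> real n ^ t" if A: "A \<in> rich_sections n t L" for A :: "(real ^ 'd) set"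
  proof -
    have "card A \<le> n ^ t" using A n1 by (auto simp: rich_sections_def intro!: card_grid_affine_le)
    then show ?thesis by (metis of_nat_le_iff of_nat_power)
  qed
  show "card {A \<in> rich_sections n t L. x \<in> A} \<le> D" if "x \<in> grid n" for x :: "real ^ 'd"
  proof -
    let ?B = "{B. affine B \<and> aff_dim B = int t \<and> x \<in> B \<and> n ^ t \<le> L * card (B \<inter> grid n)}"
    have m: "sparse_const t * L < sparse_const t * L + 1" by simp
    have B1: "finite ?B" by (rule rich_flats(1)[OF t(1) m n])
    have B2: "card ?B \<le> D" unfolding D by (rule rich_flats(2)[OF t(1) m n])
    note B = B1 B2
    have "{A \<in> rich_sections n t L. x \<in> A} \<subseteq> (\<lambda>B. B \<inter> grid n) ` ?B"
      by (auto simp: rich_sections_def)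
    then have "card {A \<in> rich_sections n t L. x \<in> A} \<le> card ((\<lambda>B. B \<inter> grid n) ` ?B)"
      using B(1) by (intro card_mono) auto
    also have "\<dots> \<le> card ?B" by (rule card_image_le[OF B(1)])
    finally show ?thesis using B(2) by simp
  qed
  show "(if u = 1 then b / real L else b) \<le> b" for u :: nat
    using b0 L by (simp add: divide_le_eq mult_le_cancel_left1)
  show "0 \<le> b" by (rule b0)
  show "1 \<le> real n ^ t" using n1 by (intro one_le_power) simp
  show "real (codegree (bad_tuples n t M L) (grid n) U)
      \<le> (if card U = 1 then b / real L else b) * (real n ^ t) ^ (M - card U)"
    if U: "U \<subseteq> grid n" "1 \<le> card U" "card U < M" for U :: "(real ^ 'd) set"
  proof (cases "card U = 1")
    case True
    then obtain x where "U = {x}" by (rule card_1_singletonE)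
    then show ?thesis using bad_tuples_degree[of x n t L M] U t Ln L M by (simp add: b)
  next
    case False
    then show ?thesis using bad_tuples_codegree[OF U(1,2) t n1 M] by (simp add: b)
  qed
qed

section \<open>A lower bound for tuples in a large set\<close>

lemma general_position_insert:
  fixes U :: "(real ^ 'd) set"
  assumes U: "general_position s U" "finite U"
    and y: "\<And>W. W \<subseteq> U \<Longrightarrow> card W \<le> s \<Longrightarrow> y \<notin> affine hull W"
  shows "general_position s (insert y U)"
  unfolding general_position_def
proof (intro allI impI)
  fix W assume W: "W \<subseteq> insert y U" "card W \<le> s + 1"
  show "\<not> affine_dependent W"
  proof (cases "y \<in> W")
    case False
    then show ?thesis using W U by (auto simp: general_position_def)
  next
    case True
    let ?W = "W - {y}"
    have fin: "finite W" using W(1) U(2) finite_subset by auto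
    have sub: "?W \<subseteq> U" using W(1) by auto
    have "card W = Suc (card ?W)" using True fin by (metis card.remove)
    then have c: "card ?W \<le> s" using W(2) by simp
    have "\<not> affine_dependent ?W" using U(1) sub c by (auto simp: general_position_def)
    then have "\<not> affine_dependent (insert y ?W)" using y[OF sub c] by (intro affine_independent_insert)
    then show ?thesis using True by (simp add: insert_absorb)
  qed
qed

text \<open>Greedy extension. A new point must avoid the hulls of the subsets with at most
  \<open>s\<close> points; there are at most \<open>2 ^ M\<close> of them and each hull contains at
  most \<open>g\<close> points of \<open>Y\<close>, so at least \<open>h\<close> choices remain. A
  tuple arises from at most \<open>M\<close> pairs of a shorter tuple and a new point, hence the
  division by \<open>M\<close> in each of the \<open>M - 1\<close> extensions.\<close>

lemma many_general_tuples:
  fixes Y :: "(real ^ 'd) set" and g h :: real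
  assumes Y: "finite Y" "x \<in> Y" and s: "1 \<le> s" and M: "1 \<le> M"
    and flats: "\<And>F. affine F \<Longrightarrow> aff_dim F \<le> int s - 1 \<Longrightarrow> real (card (Y \<inter> F)) \<le> g"
    and large: "2 ^ M * g + h \<le> real (card Y)" and "0 \<le> g" "0 \<le> h"
  shows "(h / real M) ^ (M - 1) \<le> real (card {T. T \<subseteq> Y \<and> x \<in> T \<and> card T = M \<and> general_position s T})"
proof -
  define G where "G u = {T. T \<subseteq> Y \<and> x \<in> T \<and> card T = u \<and> general_position s T}" for u
  have finG: "finite (G u)" for u
    by (rule finite_subset[of _ "Pow Y"]) (auto simp: G_def Y(1))
  have finT: "finite T" if "T \<in> G u" for T u using that Y(1) finite_subset by (auto simp: G_def)
  have step: "real (card (G u)) * h \<le> real M * real (card (G (Suc u)))" if u: "u < M" for u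
  proof -
    define good where "good U = {y \<in> Y. \<forall>W\<subseteq>U. card W \<le> s \<longrightarrow> y \<notin> affine hull W}" for U
    have good: "h \<le> real (card (good U))" if U: "U \<in> G u" for U
    proof -
      let ?B = "\<Union>W\<in>{W. W \<subseteq> U \<and> card W \<le> s}. Y \<inter> affine hull W"
      have finW: "finite {W. W \<subseteq> U \<and> card W \<le> s}" using finT[OF U] by simp
      have "Y \<subseteq> good U \<union> ?B" by (auto simp: good_def)
      then have "card Y \<le> card (good U \<union> ?B)"
        by (rule card_mono[rotated]) (use Y(1) finW in \<open>auto simp: good_def\<close>)
      also have "\<dots> \<le> card (good U) + card ?B" by (rule card_Un_le)
      also have "card ?B \<le> (\<Sum>W\<in>{W. W \<subseteq> U \<and> card W \<le> s}. card (Y \<inter> affine hull W))"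
        by (rule card_UN_le[OF finW])
      finally have "card Y \<le> card (good U) + (\<Sum>W\<in>{W. W \<subseteq> U \<and> card W \<le> s}. card (Y \<inter> affine hull W))"
        by simp
      then have "real (card Y) \<le> real (card (good U) + (\<Sum>W\<in>{W. W \<subseteq> U \<and> card W \<le> s}. card (Y \<inter> affine hull W)))"
        by (rule of_nat_mono)
      also have "\<dots> = real (card (good U)) + (\<Sum>W\<in>{W. W \<subseteq> U \<and> card W \<le> s}. real (card (Y \<inter> affine hull W)))"
        by (simp only: of_nat_add of_nat_sum)
      also have "(\<Sum>W\<in>{W. W \<subseteq> U \<and> card W \<le> s}. real (card (Y \<inter> affine hull W)))
          \<le> (\<Sum>W\<in>{W. W \<subseteq> U \<and> card W \<le> s}. g)"
      proof (rule sum_mono)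
        fix W assume W: "W \<in> {W. W \<subseteq> U \<and> card W \<le> s}"
        then have "finite W" using finT[OF U] finite_subset by auto
        then have "aff_dim W \<le> int (card W) - 1" by (rule aff_dim_le_card)
        with W show "real (card (Y \<inter> affine hull W)) \<le> g"
          by (intro flats) (auto simp: affine_affine_hull)
      qed
      also have "\<dots> = real (card {W. W \<subseteq> U \<and> card W \<le> s}) * g" by simp
      also have "\<dots> \<le> 2 ^ M * g"
      proof (rule mult_right_mono[OF _ \<open>0 \<le> g\<close>])
        have "card {W. W \<subseteq> U \<and> card W \<le> s} \<le> card (Pow U)"
          using finT[OF U] by (intro card_mono) auto
        also have "\<dots> = 2 ^ u" using U finT[OF U] by (simp add: card_Pow G_def)
        also have "\<dots> \<le> 2 ^ M" using u by (intro power_increasing) auto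
        finally have "real (card {W. W \<subseteq> U \<and> card W \<le> s}) \<le> real (2 ^ M)" by (rule of_nat_mono)
        then show "real (card {W. W \<subseteq> U \<and> card W \<le> s}) \<le> 2 ^ M" by simp
      qed
      finally show ?thesis using large by simp
    qed
    have notin: "y \<notin> U" if "y \<in> good U" for y U
    proof
      assume "y \<in> U"
      then have "y \<notin> affine hull {y}" using that s unfolding good_def by auto
      then show False by simp
    qed
    \<comment> \<open>Double counting of extensions: a pair is recovered from the longer tuple by
      naming the point that was added last.\<close>
    have "Sigma (G u) good \<subseteq> (\<Union>T\<in>G (Suc u). (\<lambda>y. (T - {y}, y)) ` T)"
    proof
      fix z assume "z \<in> Sigma (G u) good"
      then obtain U y where z: "z = (U, y)" "U \<in> G u" "y \<in> good U" by blast
      have "general_position s (insert y U)"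
        using z finT[OF z(2)] by (intro general_position_insert) (auto simp: G_def good_def)
      then have "insert y U \<in> G (Suc u)"
        using z notin[OF z(3)] finT[OF z(2)] by (auto simp: G_def good_def)
      moreover have "z \<in> (\<lambda>y'. (insert y U - {y'}, y')) ` insert y U"
        using z(1) notin[OF z(3)] by (intro image_eqI[of _ _ y]) auto
      ultimately show "z \<in> (\<Union>T\<in>G (Suc u). (\<lambda>y. (T - {y}, y)) ` T)" by blast
    qed
    then have "card (Sigma (G u) good) \<le> card (\<Union>T\<in>G (Suc u). (\<lambda>y. (T - {y}, y)) ` T)"
      by (rule card_mono[rotated]) (use finG finT in blast)
    also have "\<dots> \<le> (\<Sum>T\<in>G (Suc u). card ((\<lambda>y. (T - {y}, y)) ` T))" by (rule card_UN_le[OF finG])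
    also have "\<dots> \<le> (\<Sum>T\<in>G (Suc u). M)"
    proof (rule sum_mono)
      fix T assume T: "T \<in> G (Suc u)"
      have "card ((\<lambda>y. (T - {y}, y)) ` T) \<le> card T" by (rule card_image_le[OF finT[OF T]])
      then show "card ((\<lambda>y. (T - {y}, y)) ` T) \<le> M" using T u by (simp add: G_def)
    qed
    finally have "card (Sigma (G u) good) \<le> M * card (G (Suc u))" by (simp add: mult.commute)
    moreover have "card (Sigma (G u) good) = (\<Sum>U\<in>G u. card (good U))"
      using finG Y(1) by (intro card_SigmaI) (auto simp: good_def)
    ultimately have "(\<Sum>U\<in>G u. card (good U)) \<le> M * card (G (Suc u))" by simp
    then have "real (\<Sum>U\<in>G u. card (good U)) \<le> real (M * card (G (Suc u)))" by (rule of_nat_mono)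
    moreover have "(\<Sum>U\<in>G u. h) \<le> (\<Sum>U\<in>G u. real (card (good U)))" by (rule sum_mono[OF good])
    ultimately show ?thesis by simp
  qed
  have "(h / real M) ^ u \<le> real (card (G (Suc u)))" if "u < M" for u
    using that
  proof (induction u)
    case 0
    have "{x} \<in> G 1"
    proof -
      have "\<not> affine_dependent W" if "W \<subseteq> {x}" for W
        using subset_singletonD[OF that] by (elim disjE) simp_all
      then have "general_position s {x}" unfolding general_position_def by blast
      then show ?thesis using Y(2) by (simp add: G_def)
    qed
    then have "card (G 1) \<noteq> 0" using finG[of 1] by auto
    then show ?case by simp
  next
    case (Suc u)
    have "(h / real M) ^ Suc u = (h / real M) ^ u * h / real M" by simp
    also have "\<dots> \<le> real (card (G (Suc u))) * h / real M"
      using Suc \<open>0 \<le> h\<close> by (intro divide_right_mono mult_right_mono) auto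
    also have "\<dots> \<le> real (card (G (Suc (Suc u))))"
      using step[of "Suc u"] Suc.prems M by (simp add: divide_le_eq mult.commute)
    finally show ?case .
  qed
  from this[of "M - 1"] show ?thesis using M by (simp add: G_def)
qed

section \<open>Axis-aligned flats\<close>

lemma span_axes: "span ((\<lambda>i. axis i (1::real)) ` I) = {v :: real ^ 'd. \<forall>j. j \<notin> I \<longrightarrow> v $ j = 0}"
proof
  show "span ((\<lambda>i. axis i 1) ` I) \<subseteq> {v :: real ^ 'd. \<forall>j. j \<notin> I \<longrightarrow> v $ j = 0}"
    by (rule span_minimal) (auto simp: subspace_def axis_def)
  show "{v :: real ^ 'd. \<forall>j. j \<notin> I \<longrightarrow> v $ j = 0} \<subseteq> span ((\<lambda>i. axis i 1) ` I)"
  proof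
    fix v :: "real ^ 'd" assume v: "v \<in> {v. \<forall>j. j \<notin> I \<longrightarrow> v $ j = 0}"
    have eq: "v = (\<Sum>i\<in>I. v $ i *\<^sub>R axis i 1)"
    proof (rule vec_eq_iff[THEN iffD2], rule allI)
      fix j
      have "(\<Sum>i\<in>I. v $ i *\<^sub>R axis i 1) $ j = (\<Sum>i\<in>I. if i = j then v $ j else 0)"
        unfolding sum_component by (intro sum.cong) (auto simp: axis_def)
      then show "v $ j = (\<Sum>i\<in>I. v $ i *\<^sub>R axis i 1) $ j" using v by (simp add: sum.delta)
    qed
    have "(\<Sum>i\<in>I. v $ i *\<^sub>R axis i 1) \<in> span ((\<lambda>i. axis i 1) ` I)"
      by (intro span_sum span_scale span_base) auto
    then show "v \<in> span ((\<lambda>i. axis i 1) ` I)" by (subst eq)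
  qed
qed

lemma axis_aligned_subspaceE:
  fixes A :: "(real ^ 'd) set"
  assumes "axis_aligned_subspace t A"
  obtains a I where "card I = t" "A = {x. \<forall>j. j \<notin> I \<longrightarrow> x $ j = a $ j}" "affine A" "aff_dim A = int t"
proof -
  obtain a :: "real ^ 'd" and I where I: "card I = t"
    and A: "A = (\<lambda>x. a + x) ` span ((\<lambda>i. axis i 1) ` I)"
    using assms unfolding axis_aligned_subspace_def by blast
  have "A = {x. \<forall>j. j \<notin> I \<longrightarrow> x $ j = a $ j}"
    unfolding A span_axes
  proof (intro set_eqI iffI)
    fix x assume "x \<in> {x. \<forall>j. j \<notin> I \<longrightarrow> x $ j = a $ j}"
    then show "x \<in> (\<lambda>x. a + x) ` {v. \<forall>j. j \<notin> I \<longrightarrow> v $ j = 0}"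
      by (intro image_eqI[of _ _ "x - a"]) auto
  qed auto
  moreover have "affine A" unfolding A using subspace_imp_affine[OF subspace_span] affine_translation by blast
  moreover have "aff_dim A = int t"
  proof -
    have inj: "inj (\<lambda>i::'d. axis i (1::real))" by (rule injI) (simp add: axis_eq_axis)
    have sub: "(\<lambda>i. axis i 1) ` I \<subseteq> (Basis :: (real ^ 'd) set)" by auto
    have "aff_dim A = int (dim (span ((\<lambda>i. axis i (1::real)) ` I :: (real ^ 'd) set)))"
      unfolding A by (simp add: aff_dim_translation_eq aff_dim_subspace)
    also have "dim (span ((\<lambda>i. axis i (1::real)) ` I :: (real ^ 'd) set)) = card ((\<lambda>i. axis i (1::real)) ` I :: (real ^ 'd) set)"
      unfolding dim_span by (intro dim_eq_card_independent independent_mono[OF independent_Basis sub])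
    also have "\<dots> = t" using inj I by (simp add: card_image inj_on_subset)
    finally show ?thesis .
  qed
  ultimately show ?thesis using I that by blast
qed

lemma axis_aligned_subspaceI:
  fixes a :: "real ^ 'd"
  assumes "card I = t"
  shows "axis_aligned_subspace t {x. \<forall>j. j \<notin> I \<longrightarrow> x $ j = a $ j}"
proof -
  have "{x. \<forall>j. j \<notin> I \<longrightarrow> x $ j = a $ j} = (\<lambda>x. a + x) ` span ((\<lambda>i. axis i 1) ` I)"
    unfolding span_axes
  proof (intro set_eqI iffI)
    fix x assume "x \<in> {x. \<forall>j. j \<notin> I \<longrightarrow> x $ j = a $ j}"
    then show "x \<in> (\<lambda>x. a + x) ` {v. \<forall>j. j \<notin> I \<longrightarrow> v $ j = 0}"
      by (intro image_eqI[of _ _ "x - a"]) auto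
  qed auto
  then show ?thesis using assms unfolding axis_aligned_subspace_def by blast
qed

lemma grid_iff: "x \<in> grid n \<longleftrightarrow> (\<forall>i. x $ i \<in> real ` {1..n})"
  by (auto simp: grid_def image_iff)

lemma card_axis_aligned_grid:
  fixes A :: "(real ^ 'd) set"
  assumes "axis_aligned_subspace t A" "A \<inter> grid n \<noteq> {}"
  shows "n ^ t \<le> card (A \<inter> grid n)"
proof -
  obtain a I where I: "card I = t" and A: "A = {x. \<forall>j. j \<notin> I \<longrightarrow> x $ j = a $ j}"
    by (rule axis_aligned_subspaceE[OF assms(1)])
  obtain z where z: "z \<in> A" "z \<in> grid n" using assms(2) by blast
  define g where "g f = (\<chi> i. if i \<in> I then f i else z $ i)" for f :: "'d \<Rightarrow> real"
  let ?P = "PiE I (\<lambda>_. real ` {1..n})"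
  have inj: "inj_on g ?P"
  proof (rule inj_onI)
    fix f f' assume f: "f \<in> ?P" "f' \<in> ?P" and eq: "g f = g f'"
    show "f = f'"
    proof (rule PiE_ext[OF f])
      fix i assume "i \<in> I"
      then show "f i = f' i" using arg_cong[OF eq, of "\<lambda>v. v $ i"] by (simp add: g_def)
    qed
  qed
  have sub: "g ` ?P \<subseteq> A \<inter> grid n"
  proof (intro image_subsetI IntI)
    fix f assume f: "f \<in> ?P"
    show "g f \<in> A" using z(1) by (simp add: g_def A)
    show "g f \<in> grid n"
      unfolding grid_iff
    proof
      fix i
      show "g f $ i \<in> real ` {1..n}"
        using PiE_mem[OF f, of i] z(2)[unfolded grid_iff, rule_format, of i]
        by (cases "i \<in> I") (simp_all add: g_def)
    qed
  qed
  have "card ?P = n ^ t" using I by (simp add: card_PiE card_image inj_on_def)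
  then have "n ^ t = card (g ` ?P)" using inj by (simp add: card_image)
  also have "\<dots> \<le> card (A \<inter> grid n)" using sub by (intro card_mono) (simp add: finite_grid)
  finally show ?thesis .
qed

text \<open>The grid is partitioned by \<open>n ^ (CARD('d) - t)\<close> parallel axis-aligned flats
  with free coordinates in one fixed set \<open>I\<close>. The value 1 in the free coordinates of
  the base point merely ensures that it is a grid point.\<close>

lemma card_from_axis_aligned:
  fixes S :: "(real ^ 'd) set" and c :: real
  assumes S: "S \<subseteq> grid n" and n: "1 \<le> n" and t: "t \<le> CARD('d)"
    and c: "\<And>A. axis_aligned_subspace t A \<Longrightarrow> A \<inter> grid n \<noteq> {} \<Longrightarrow> c \<le> real (card (S \<inter> A))"
  shows "c * real n ^ (CARD('d) - t) \<le> real (card S)"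
proof -
  obtain I :: "'d set" where I: "card I = t" using obtain_subset_with_card_n[OF t] by metis
  let ?P = "PiE (- I) (\<lambda>_. real ` {1..n})"
  define a where "a f = (\<chi> i. if i \<in> I then 1 else f i)" for f :: "'d \<Rightarrow> real"
  define A where "A f = {x. \<forall>j. j \<notin> I \<longrightarrow> x $ j = a f $ j}" for f
  have finS: "finite S" using S finite_grid finite_subset by blast
  have finP: "finite ?P" by (intro finite_PiE) auto
  have cover: "(\<Union>f\<in>?P. S \<inter> A f) = S"
  proof
    show "S \<subseteq> (\<Union>f\<in>?P. S \<inter> A f)"
    proof
      fix x assume x: "x \<in> S"
      let ?f = "restrict (vec_nth x) (- I)"
      have "?f \<in> ?P" using x S by (auto simp: grid_iff)
      moreover have "x \<in> A ?f" by (simp add: A_def a_def)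
      ultimately show "x \<in> (\<Union>f\<in>?P. S \<inter> A f)" using x by blast
    qed
  qed auto
  have disj: "(S \<inter> A f) \<inter> (S \<inter> A f') = {}" if f: "f \<in> ?P" "f' \<in> ?P" "f \<noteq> f'" for f f'
  proof (rule ccontr)
    assume "\<not> ?thesis"
    then obtain x where x: "x \<in> A f" "x \<in> A f'" by blast
    have "f = f'"
    proof (rule PiE_ext[OF f(1,2)])
      fix i assume "i \<in> - I"
      then have "x $ i = f i" "x $ i = f' i" using x by (auto simp: A_def a_def)
      then show "f i = f' i" by simp
    qed
    then show False using f(3) by simp
  qed
  have "card ?P = n ^ card (- I)" by (simp add: card_PiE card_image inj_on_def)
  also have "card (- I) = CARD('d) - t" using I by (simp add: Compl_eq_Diff_UNIV card_Diff_subset)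
  finally have cardP: "card ?P = n ^ (CARD('d) - t)" .
  have "c * real n ^ (CARD('d) - t) = (\<Sum>f\<in>?P. c)"
    by (simp only: sum_constant cardP of_nat_power mult.commute)
  also have "\<dots> \<le> (\<Sum>f\<in>?P. real (card (S \<inter> A f)))"
  proof (rule sum_mono)
    fix f assume f: "f \<in> ?P"
    have "a f \<in> grid n" using f n by (auto simp: grid_iff a_def)
    moreover have "a f \<in> A f" by (simp add: A_def)
    ultimately have "A f \<inter> grid n \<noteq> {}" by blast
    then show "c \<le> real (card (S \<inter> A f))"
      unfolding A_def by (intro c axis_aligned_subspaceI[OF I])
  qed
  also have "\<dots> = real (card (\<Union>f\<in>?P. S \<inter> A f))"
    using finP finS disj by (subst card_UN_disjoint) auto
  finally show ?thesis using cover by simp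
qed

subsection \<open>The theorem\<close>

text \<open>By induction on the dimension \<open>s\<close> with thresholds \<open>q ^ s\<close>: the ratio \<open>q = 2 ^ M + 1\<close> leaves room for
  extending a tuple while avoiding the flats spanned by its at most \<open>2 ^ M\<close> subsets.\<close>

lemma few_points_on_sparse_flats:
  fixes S C :: "(real ^ 'd) set" and k q :: real
  assumes S: "S \<subseteq> grid n" and n: "1 \<le> n" and M: "t + 1 \<le> M"
    and deg: "\<And>x. x \<in> S \<Longrightarrow>
      real (codegree (bad_tuples n t M L) S {x}) < (k / q ^ t / real M) ^ (M - 1)"
    and q: "q = 2 ^ M + 1" and k: "q ^ t \<le> k"
    and C: "affine C" "aff_dim C \<le> int s" "s \<le> t" "s = t \<Longrightarrow> L * card (C \<inter> grid n) < n ^ t"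
  shows "real (card (S \<inter> C)) \<le> q ^ s * (k / q ^ t)"
  using C
proof (induction s arbitrary: C)
  case 0
  have q1: "1 \<le> q" by (simp add: q)
  \<comment> \<open>A flat of dimension at most 0 holds at most one point, and the hypothesis on
    \<open>k\<close> makes the threshold at least 1.\<close>
  have "card (S \<inter> C) \<le> card (C \<inter> grid n)" using S by (intro card_mono) (auto simp: finite_grid)
  also have "\<dots> \<le> n ^ 0" using 0 n by (intro card_grid_affine_le) auto
  finally have "real (card (S \<inter> C)) \<le> 1" by simp
  also have "1 \<le> k / q ^ t" using k q1 by simp
  finally show ?case by simp
next
  case (Suc s)
  define w where "w = k / q ^ t"
  have q1: "1 \<le> q" by (simp add: q)
  have w: "1 \<le> w" using k q1 by (simp add: w_def)
  have qs: "w \<le> q ^ s * w" using q1 w mult_right_mono[of 1 "q ^ s" w] one_le_power[of q s] by simp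
  have finS: "finite S" using S finite_grid finite_subset by blast
  show ?case
  proof (rule ccontr)
    assume "\<not> ?case"
    then have large: "q ^ Suc s * w < real (card (S \<inter> C))" by (simp add: w_def)
    moreover have "0 \<le> q ^ Suc s * w" using q1 w by simp
    ultimately have "0 < card (S \<inter> C)" by linarith
    then obtain x where x: "x \<in> S \<inter> C" by (metis card_gt_0_iff ex_in_conv)
    have "(w / real M) ^ (M - 1) \<le> (q ^ s * w / real M) ^ (M - 1)"
      using qs w by (intro power_mono divide_right_mono) auto
    also have "\<dots> \<le> real (card {T. T \<subseteq> S \<inter> C \<and> x \<in> T \<and> card T = M \<and> general_position (Suc s) T})"
    proof (rule many_general_tuples[where g = "q ^ s * w"])
      show "finite (S \<inter> C)" using finS by simp
      show "x \<in> S \<inter> C" by (rule x)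
      have "2 ^ M * (q ^ s * w) + q ^ s * w = q ^ Suc s * w" by (simp add: q algebra_simps)
      then show "2 ^ M * (q ^ s * w) + q ^ s * w \<le> real (card (S \<inter> C))" using large by simp
      fix F :: "(real ^ 'd) set" assume F: "affine F" "aff_dim F \<le> int (Suc s) - 1"
      have "card ((S \<inter> C) \<inter> F) \<le> card (S \<inter> F)" using finS by (intro card_mono) auto
      moreover have "real (card (S \<inter> F)) \<le> q ^ s * w"
        unfolding w_def using F Suc.prems by (intro Suc.IH) auto
      ultimately show "real (card ((S \<inter> C) \<inter> F)) \<le> q ^ s * w" by linarith
    qed (use M q1 w in auto)
    also have "\<dots> \<le> real (codegree (bad_tuples n t M L) S {x})"
      unfolding codegree_def
    proof (intro of_nat_mono card_mono)
      show "finite {T \<in> bad_tuples n t M L. {x} \<subseteq> T \<and> T \<subseteq> S}"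
        by (rule finite_subset[OF _ finite_bad_tuples]) auto
      show "{T. T \<subseteq> S \<inter> C \<and> x \<in> T \<and> card T = M \<and> general_position (Suc s) T}
          \<subseteq> {T \<in> bad_tuples n t M L. {x} \<subseteq> T \<and> T \<subseteq> S}"
      proof
        fix T assume "T \<in> {T. T \<subseteq> S \<inter> C \<and> x \<in> T \<and> card T = M \<and> general_position (Suc s) T}"
        then have T: "T \<subseteq> S" "T \<subseteq> C" "x \<in> T" "card T = M" "general_position (Suc s) T" by auto
        \<comment> \<open>\<open>T\<close> has more than \<open>Suc s\<close> points in general
          position inside \<open>C\<close>, so it spans a flat of dimension exactly
          \<open>Suc s\<close>. This makes it a bad tuple: if \<open>Suc s = t\<close>, its span
          inherits poverty from \<open>C\<close>, and below \<open>t\<close> no poverty is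
          required.\<close>
        have "int (Suc s) \<le> aff_dim T"
          using T(4) M Suc.prems(3) by (intro aff_dim_general_position[OF T(5)]) auto
        moreover have "aff_dim T \<le> int (Suc s)" using aff_dim_subset[OF T(2)] Suc.prems(2) by linarith
        ultimately have dim: "aff_dim T = int (Suc s)" by simp
        have "L * card (affine hull T \<inter> grid n) < n ^ t" if "Suc s = t"
        proof -
          have "affine hull T \<subseteq> C" using T(2) Suc.prems(1) by (rule hull_minimal)
          then have "card (affine hull T \<inter> grid n) \<le> card (C \<inter> grid n)"
            by (intro card_mono) (auto simp: finite_grid)
          then have "L * card (affine hull T \<inter> grid n) \<le> L * card (C \<inter> grid n)" by simp
          then show ?thesis using Suc.prems(4)[OF that] by linarith
        qed
        then have "T \<in> bad_tuples n t M L"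
          unfolding bad_tuples_def using T S Suc.prems(3) dim
          by (intro CollectI conjI bexI[of _ "Suc s"]) auto
        then show "T \<in> {T \<in> bad_tuples n t M L. {x} \<subseteq> T \<and> T \<subseteq> S}" using T by simp
      qed
    qed
    finally show False using deg[of x] x by (simp add: w_def)
  qed
qed

lemma theorem1p3_fixed_dimension:
  fixes \<epsilon> :: real
  assumes \<epsilon>: "0 < \<epsilon>" "\<epsilon> \<le> 1" and t: "1 \<le> t" "t \<le> CARD('d::finite)"
  shows "\<exists>K. \<forall>n k :: nat. 1 \<le> n \<longrightarrow> K \<le> real k \<longrightarrow> k \<le> n ^ t \<longrightarrow>
      (\<exists>S \<subseteq> (grid n :: (real ^ 'd) set). at_most_per_subspace k t S \<and>
        (\<forall>A. axis_aligned_subspace t A \<and> A \<inter> grid n \<noteq> {} \<longrightarrow> (1 - \<epsilon>) * real k \<le> real (card (S \<inter> A))))"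
proof -
  define M where "M = tuple_size CARD('d)"
  define q :: real where "q = 2 ^ M + 1"
  define b where "b = codegree_const CARD('d)"
  \<comment> \<open>Chosen so that \<open>\<eta> * k ^ (M - 1)\<close> is the degree forced by an
    overfull poor flat. \<open>L\<close> then makes the initial degree factor \<open>b / L\<close>
    at most a quarter of it.\<close>
  define \<eta> where "\<eta> = (1 / q ^ t / real M) ^ (M - 1)"
  define L where "L = nat \<lceil>4 * b / \<eta>\<rceil> + 1"
  define N where "N = sparse_const t * L + 1"
  define D where "D = (3 ^ (t + 1) * N) ^ (CARD('d) * t)"
  \<comment> \<open>One quarter of \<eta> for the error in the degrees, one quarter of \<epsilon>
    for the error on rich flats.\<close>
  define e where "e = min (\<epsilon> / 4) (\<eta> / 4)"
  have q1: "1 \<le> q" by (simp add: q_def)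
  have M: "t + 1 \<le> M" "2 \<le> M" using t by (simp_all add: M_def tuple_size_def tuple_exponent_def)
  have \<eta>: "0 < \<eta>" using q1 M by (simp add: \<eta>_def)
  have b: "0 \<le> b" by (simp add: b_def codegree_const_nonneg)
  have e: "0 < e" "e \<le> \<epsilon> / 4" "e \<le> \<eta> / 4" using \<epsilon> \<eta> by (auto simp: e_def)
  have L: "1 \<le> L" by (simp add: L_def)
  have bL: "b / real L \<le> \<eta> / 4"
  proof -
    have "4 * b / \<eta> \<le> real L" unfolding L_def by linarith
    then have "4 * b \<le> real L * \<eta>" using \<eta> by (simp add: pos_divide_le_eq)
    then show ?thesis using L by (simp add: pos_divide_le_eq mult.commute)
  qed
  obtain k1 where k1: "k1 \<ge> 1" and sparse: "\<And>(X :: (real ^ 'd) set) H \<A> \<beta> K0 k.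
      thinning_system X H \<A> M D \<beta> b K0 \<Longrightarrow> k1 \<le> k \<Longrightarrow> k \<le> K0 \<Longrightarrow>
      \<exists>S. regular_subset X H \<A> M \<beta> K0 S k e"
    using sparsification[OF b e(1) M(2), of D, where 'a = "real ^ 'd"] by metis
  \<comment> \<open>\<open>2 * k1\<close> and \<open>2 * q ^ t\<close> provide for a target of at
    least half of \<open>k\<close>. The term \<open>N ^ t\<close> forces \<open>n \<ge> N\<close>
    through \<open>k \<le> n ^ t\<close>, so small grids are excluded by the bound on
    \<open>k\<close>.\<close>
  define K where "K = 2 * k1 + real (N ^ t) + 2 * q ^ t"
  have "\<exists>S \<subseteq> (grid n :: (real ^ 'd) set). at_most_per_subspace k t S \<and>
        (\<forall>A. axis_aligned_subspace t A \<and> A \<inter> grid n \<noteq> {} \<longrightarrow> (1 - \<epsilon>) * real k \<le> real (card (S \<inter> A)))"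
    if n: "1 \<le> n" and Kk: "K \<le> real k" and kn: "k \<le> n ^ t" for n k
  proof -
    \<comment> \<open>Aiming below \<open>k\<close> leaves room on both sides:
      \<open>(1 + \<epsilon> / 4) * k' \<le> k\<close>, while
      \<open>(1 - \<epsilon> / 4) * k'\<close> is still at least
      \<open>(1 - \<epsilon>) * k\<close>.\<close>
    define k' where "k' = (1 - \<epsilon> / 2) * real k"
    have qt: "1 \<le> q ^ t" using q1 by (rule one_le_power)
    have "real (N ^ t) \<ge> 0" by simp
    then have k2: "2 * k1 \<le> real k" "real (N ^ t) < real k" "2 * q ^ t \<le> real k"
      using Kk qt k1 unfolding K_def by linarith+
    have "real k / 2 \<le> k'"
      unfolding k'_def using \<epsilon> mult_right_mono[of "1/2" "1 - \<epsilon> / 2" "real k"] by simp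
    then have k': "k1 \<le> k'" "q ^ t \<le> k'" "0 < k'" using k2 qt by linarith+
    have k'k: "k' \<le> real k" unfolding k'_def using \<epsilon> mult_right_mono[of "1 - \<epsilon> / 2" 1 "real k"] by simp
    have knr: "real k \<le> real n ^ t" using kn by (metis of_nat_le_iff of_nat_power)
    have Nn: "N \<le> n"
    proof (rule ccontr)
      assume "\<not> N \<le> n"
      then have "n ^ t \<le> N ^ t" by (intro power_mono) auto
      then show False using kn k2(2) by simp
    qed
    let ?H = "bad_tuples n t M L" and ?R = "rich_sections n t L :: (real ^ 'd) set set"
    have "thinning_system (grid n :: (real ^ 'd) set) ?H ?R M D
        (\<lambda>u. if u = 1 then b / real L else b) b (real n ^ t)"
      using Nn by (intro grid_thinning_system t L M_def b_def) (simp_all add: N_def D_def)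
    then obtain S where S: "regular_subset (grid n :: (real ^ 'd) set) ?H ?R M
        (\<lambda>u. if u = 1 then b / real L else b) (real n ^ t) S k' e"
      using sparse k' k'k knr by (metis order_trans)
    have Sg: "S \<subseteq> grid n" using S by (simp add: regular_subset_def)
    have deg: "real (codegree ?H S {x}) < (k' / q ^ t / real M) ^ (M - 1)" if x: "x \<in> S" for x
    proof -
      have "real (codegree ?H S {x}) \<le> (b / real L + e) * k' ^ (M - 1)"
        using S[unfolded regular_subset_def, THEN conjunct2, THEN conjunct1, rule_format, of "{x}"] x M
        by simp
      also have "\<dots> < \<eta> * k' ^ (M - 1)"
      proof (rule mult_strict_right_mono)
        show "b / real L + e < \<eta>" using bL e \<eta> by linarith
      qed (use k'(3) in simp)
      also have "\<dots> = (k' / q ^ t / real M) ^ (M - 1)"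
        unfolding \<eta>_def power_mult_distrib [symmetric] by simp
      finally show ?thesis .
    qed
    have rich: "\<bar>real (card (S \<inter> A)) - real (card (A \<inter> grid n)) * k' / real n ^ t\<bar> \<le> e * k'"
      if A: "affine A" "aff_dim A = int t" "n ^ t \<le> L * card (A \<inter> grid n)" for A
    proof -
      have "A \<inter> grid n \<in> ?R" using A by (auto simp: rich_sections_def)
      moreover have "S \<inter> (A \<inter> grid n) = S \<inter> A" using Sg by blast
      ultimately show ?thesis using S unfolding regular_subset_def by metis
    qed
    have "at_most_per_subspace k t S"
      unfolding at_most_per_subspace_def affine_subspace_def
    proof (intro allI impI, elim conjE)
      fix A :: "(real ^ 'd) set" assume A: "affine A" "aff_dim A = int t"
      have "real (card (S \<inter> A)) \<le> real k"
      proof (cases "n ^ t \<le> L * card (A \<inter> grid n)")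
        case True
        have "card (A \<inter> grid n) \<le> n ^ t" using A n by (intro card_grid_affine_le) auto
        then have "real (card (A \<inter> grid n)) \<le> real n ^ t" by (metis of_nat_le_iff of_nat_power)
        then have "real (card (A \<inter> grid n)) * k' / real n ^ t \<le> real n ^ t * k' / real n ^ t"
          using k' by (intro divide_right_mono mult_right_mono) auto
        also have "\<dots> = k'" using n by simp
        finally have "real (card (S \<inter> A)) \<le> k' + e * k'" using rich[OF A True] by linarith
        also have "\<dots> \<le> k' + \<epsilon> / 4 * k'" using e k' by (intro add_left_mono mult_right_mono) auto
        also have "\<dots> = ((1 + \<epsilon> / 4) * (1 - \<epsilon> / 2)) * real k" by (simp add: k'_def algebra_simps)
        also have "\<dots> \<le> 1 * real k"
        proof (rule mult_right_mono)
          have "(1 + \<epsilon> / 4) * (1 - \<epsilon> / 2) = 1 - \<epsilon> / 4 - \<epsilon> * \<epsilon> / 8" by (simp add: algebra_simps)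
          moreover have "0 \<le> \<epsilon> * \<epsilon>" by simp
          ultimately show "(1 + \<epsilon> / 4) * (1 - \<epsilon> / 2) \<le> 1" using \<epsilon> by linarith
        qed simp
        finally show ?thesis by simp
      next
        case False
        have "real (card (S \<inter> A)) \<le> q ^ t * (k' / q ^ t)"
          using A False by (intro few_points_on_sparse_flats[OF Sg n M(1) deg q_def k'(2)]) auto
        also have "\<dots> = k'" using q1 by auto
        finally show ?thesis using k'k by linarith
      qed
      then show "card (S \<inter> A) \<le> k" by simp
    qed
    moreover have "(1 - \<epsilon>) * real k \<le> real (card (S \<inter> A))"
      if A: "axis_aligned_subspace t A" "A \<inter> grid n \<noteq> {}" for A
    proof -
      have aff: "affine A" "aff_dim A = int t" by (rule axis_aligned_subspaceE[OF A(1)], blast)+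
      \<comment> \<open>An axis-aligned flat that meets the grid is as rich as possible, so the
        two-sided control of rich flats supplies the lower bound.\<close>
      have "n ^ t \<le> card (A \<inter> grid n)" by (rule card_axis_aligned_grid[OF A])
      moreover have "card (A \<inter> grid n) \<le> n ^ t" using aff n by (intro card_grid_affine_le) auto
      ultimately have card: "card (A \<inter> grid n) = n ^ t" by simp
      have "real (card (A \<inter> grid n)) * k' / real n ^ t = k'" using n by (simp add: card)
      moreover have "n ^ t \<le> L * card (A \<inter> grid n)" using L by (simp add: card)
      ultimately have "k' - e * k' \<le> real (card (S \<inter> A))" using rich[OF aff] by linarith
      moreover have "e * k' \<le> \<epsilon> / 4 * k'" using e k' by (intro mult_right_mono) auto
      moreover have "\<epsilon> / 4 * k' \<le> \<epsilon> / 4 * real k" using k'k \<epsilon> by (intro mult_left_mono) auto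
      moreover have "k' = real k - \<epsilon> / 2 * real k" by (simp add: k'_def algebra_simps)
      moreover have "0 \<le> \<epsilon> / 4 * real k" using \<epsilon> by simp
      ultimately show ?thesis by (simp add: algebra_simps)
    qed
    ultimately show ?thesis using Sg by blast
  qed
  then show ?thesis by blast
qed

theorem theorem1p3:
  fixes \<epsilon> :: real
  assumes "\<epsilon> > 0"
  shows "\<exists>K\<^sub>1::real. \<forall>n k t :: nat.
    n \<ge> 1 \<and> K\<^sub>1 \<le> real k \<and> k \<le> n ^ t \<and> 1 \<le> t \<and> t \<le> CARD('d::finite) - 1 \<longrightarrow>
      (\<exists>S \<subseteq> (grid n :: (real ^ 'd) set).
        at_most_per_subspace k t S \<and>
        (\<forall>A. axis_aligned_subspace t A \<and> A \<inter> grid n \<noteq> {} \<longrightarrow>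
             real (card (S \<inter> A)) \<ge> (1 - \<epsilon>) * real k)) \<and>
      real (max_grid_subset k TYPE('d) t n) \<ge> (1 - \<epsilon>) * real k * real n ^ (CARD('d) - t)"
proof -
  \<comment> \<open>A smaller error proves a stronger bound, so \<epsilon> may be capped at 1. The
    thresholds of the finitely many values of \<open>t\<close> are merged by a maximum.\<close>
  define \<epsilon>' where "\<epsilon>' = min \<epsilon> 1"
  have \<epsilon>': "0 < \<epsilon>'" "\<epsilon>' \<le> 1" "\<epsilon>' \<le> \<epsilon>" using assms by (auto simp: \<epsilon>'_def)
  define good where "good n k t S \<longleftrightarrow> at_most_per_subspace k t S \<and>
      (\<forall>A. axis_aligned_subspace t A \<and> A \<inter> grid n \<noteq> {} \<longrightarrow> (1 - \<epsilon>') * real k \<le> real (card (S \<inter> A)))"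
    for n k t and S :: "(real ^ 'd) set"
  have "\<forall>t\<in>{1..CARD('d)}. \<exists>K. \<forall>n k. 1 \<le> n \<longrightarrow> K \<le> real k \<longrightarrow> k \<le> n ^ t \<longrightarrow> (\<exists>S\<subseteq>grid n. good n k t S)"
    unfolding good_def by (intro ballI theorem1p3_fixed_dimension[OF \<epsilon>'(1,2)]) auto
  then obtain K where K: "\<And>t n k. t \<in> {1..CARD('d)} \<Longrightarrow> 1 \<le> n \<Longrightarrow> K t \<le> real k \<Longrightarrow> k \<le> n ^ t \<Longrightarrow>
      \<exists>S\<subseteq>grid n. good n k t S"
    by metis
  show ?thesis
  proof (intro exI[of _ "Max (K ` {1..CARD('d)})"] allI impI, elim conjE)
    fix n k t :: nat
    assume n: "n \<ge> 1" and Kk: "Max (K ` {1..CARD('d)}) \<le> real k" and k: "k \<le> n ^ t"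
      and t: "1 \<le> t" "t \<le> CARD('d) - 1"
    have td: "t \<in> {1..CARD('d)}" using t by auto
    have "K t \<le> Max (K ` {1..CARD('d)})" using td by (intro Max_ge) auto
    then have "K t \<le> real k" using Kk by (rule order_trans)
    then obtain S where S: "S \<subseteq> grid n" "good n k t S" using K[OF td n _ k] by blast
    have lower: "(1 - \<epsilon>) * real k \<le> real (card (S \<inter> A))"
      if "axis_aligned_subspace t A" "A \<inter> grid n \<noteq> {}" for A
    proof -
      have "(1 - \<epsilon>) * real k \<le> (1 - \<epsilon>') * real k" using \<epsilon>' by (intro mult_right_mono) auto
      also have "\<dots> \<le> real (card (S \<inter> A))" using S(2) that by (simp add: good_def)
      finally show ?thesis .
    qed
    have am: "at_most_per_subspace k t S" using S(2) by (simp add: good_def)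
    have "card S \<le> max_grid_subset k TYPE('d) t n"
      unfolding max_grid_subset_def using S(1) am
      by (intro Max_ge max_grid_subset_candidates(1)) blast
    moreover have "(1 - \<epsilon>) * real k * real n ^ (CARD('d) - t) \<le> real (card S)"
      using td by (intro card_from_axis_aligned[OF S(1) n] lower) auto
    ultimately have "(1 - \<epsilon>) * real k * real n ^ (CARD('d) - t) \<le> real (max_grid_subset k TYPE('d) t n)"
      by linarith
    then show "(\<exists>S \<subseteq> (grid n :: (real ^ 'd) set).
        at_most_per_subspace k t S \<and>
        (\<forall>A. axis_aligned_subspace t A \<and> A \<inter> grid n \<noteq> {} \<longrightarrow>
             real (card (S \<inter> A)) \<ge> (1 - \<epsilon>) * real k)) \<and>
      real (max_grid_subset k TYPE('d) t n) \<ge> (1 - \<epsilon>) * real k * real n ^ (CARD('d) - t)"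
      using S(1) am lower by blast
  qed
qed

end
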